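(* Let $A$ be a valuation ring and let $Z$ be the set of zero divisors of $A$. For $a \in A$ write $(0:a) = \{x \in A : xa = 0\}$. (1) If $(0:a)$ is not a finitely generated ideal for every $a \in Z \setminus \{0\}$ (that is, for each $a \in Z\setminus\{0\}$ the ideal $(0:a)$ fails to be finitely generated), then $A$ is a $(2,1)$-ring. (2) If $(0:a)$ is a finitely generated ideal for some $a \in Z \setminus \{0\}$, then $A$ is not a $(2,d)$-ring for every nonnegative integer $d$ (that is, for no nonnegative integer $d$ is $A$ a $(2,d)$-ring).
   Context: All rings are commutative with identity and all modules are unital. A ring $A$ is a valuation ring if its ideals are totally ordered by inclusion; equivalently, for all $x,y\in A$, $x \in Ay$ or $y \in Ax$ (zero divisors are allowed). For a nonnegative integer $n$, an $A$-module $E$ is $n$-presented if there is an exact sequence $F_n \to F_{n-1} \to \cdots \to F_1 \to F_0 \to E \to 0$ with each $F_i$ a free $A$-module of finite rank. For nonnegative integers $n,d$, a ring $A$ is an $(n,d)$-ring if $\mathrm{pd}_A(E) \leq d$ for every $n$-presented $A$-module $E$, where $\mathrm{pd}$ denotes projective dimension. *)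

theory Defs
  imports "HOL-Algebra.Algebra" "HOL-Library.Extended_Nat"
begin

definition valuation_ring :: "('a, 'r) ring_scheme \<Rightarrow> bool" where
  "valuation_ring R \<longleftrightarrow>
     cring R \<and> (\<forall>I J. ideal I R \<and> ideal J R \<longrightarrow> I \<subseteq> J \<or> J \<subseteq> I)"

text \<open>With this convention 0 is a zero divisor of every nonzero ring.\<close>

definition zero_divisors :: "('a, 'r) ring_scheme \<Rightarrow> 'a set" where
  "zero_divisors R =
     {a \<in> carrier R. \<exists>b \<in> carrier R. b \<noteq> \<zero>\<^bsub>R\<^esub> \<and> a \<otimes>\<^bsub>R\<^esub> b = \<zero>\<^bsub>R\<^esub>}"

definition ann :: "('a, 'r) ring_scheme \<Rightarrow> 'a \<Rightarrow> 'a set" where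
  "ann R a = {x \<in> carrier R. x \<otimes>\<^bsub>R\<^esub> a = \<zero>\<^bsub>R\<^esub>}"

definition fg_ideal :: "('a, 'r) ring_scheme \<Rightarrow> 'a set \<Rightarrow> bool" where
  "fg_ideal R I \<longleftrightarrow> (\<exists>S \<subseteq> carrier R. finite S \<and> I = Idl\<^bsub>R\<^esub> S)"

definition mod_hom ::
  "('a, 'r) ring_scheme \<Rightarrow> ('a, 'm) module \<Rightarrow> ('a, 'n) module \<Rightarrow> ('m \<Rightarrow> 'n) set" where
  "mod_hom R M N =
     {f \<in> carrier M \<rightarrow> carrier N.
        (\<forall>x \<in> carrier M. \<forall>y \<in> carrier M. f (x \<oplus>\<^bsub>M\<^esub> y) = f x \<oplus>\<^bsub>N\<^esub> f y) \<and>
        (\<forall>a \<in> carrier R. \<forall>x \<in> carrier M. f (a \<odot>\<^bsub>M\<^esub> x) = a \<odot>\<^bsub>N\<^esub> f x)}"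

text \<open>A basis: every element is a linear combination of \<open>B\<close> for exactly one finitely
  supported coefficient family, extended by 0 outside \<open>B\<close>.\<close>

definition module_basis ::
  "('a, 'r) ring_scheme \<Rightarrow> ('a, 'm) module \<Rightarrow> 'm set \<Rightarrow> bool" where
  "module_basis R M B \<longleftrightarrow>
     B \<subseteq> carrier M \<and>
     (\<forall>x \<in> carrier M. \<exists>!c :: 'm \<Rightarrow> 'a.
        (\<forall>b \<in> B. c b \<in> carrier R) \<and> (\<forall>b. b \<notin> B \<longrightarrow> c b = \<zero>\<^bsub>R\<^esub>) \<and>
        finite {b \<in> B. c b \<noteq> \<zero>\<^bsub>R\<^esub>} \<and>
        x = (\<Oplus>\<^bsub>M\<^esub>b\<in>{b \<in> B. c b \<noteq> \<zero>\<^bsub>R\<^esub>}. c b \<odot>\<^bsub>M\<^esub> b))"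

definition finite_free_module :: "('a, 'r) ring_scheme \<Rightarrow> ('a, 'm) module \<Rightarrow> bool" where
  "finite_free_module R M \<longleftrightarrow> module R M \<and> (\<exists>B. finite B \<and> module_basis R M B)"

text \<open>The lifting property against epimorphisms \<open>M \<rightarrow> N\<close>. A definition cannot quantify over
  types, so \<open>M\<close> and \<open>N\<close> range over fixed carrier types. No generality is lost: \<open>N\<close> may be \<open>P\<close>
  itself and \<open>M\<close> the free module on \<open>carrier P\<close> (finitely supported functions), so the property
  makes \<open>P\<close> a direct summand of a free module, whence lifting against all epimorphisms,
  whatever the types of their carriers.\<close>

definition projective_module :: "('a, 'r) ring_scheme \<Rightarrow> ('a, 'p) module \<Rightarrow> bool" where
  "projective_module R P \<longleftrightarrow>
     module R P \<and>
     (\<forall>(M :: ('a, 'p \<Rightarrow> 'a) module) (N :: ('a, 'p) module) g f.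
        module R M \<and> module R N \<and>
        g \<in> mod_hom R M N \<and> g ` carrier M = carrier N \<and> f \<in> mod_hom R P N \<longrightarrow>
        (\<exists>h \<in> mod_hom R P M. \<forall>x \<in> carrier P. g (h x) = f x))"

text \<open>\<open>aug_exact R E F \<epsilon> \<delta> n\<close>: exactness of
  \<open>F n \<rightarrow> \<dots> \<rightarrow> F 1 \<rightarrow> F 0 \<rightarrow> E \<rightarrow> 0\<close>, with \<open>\<epsilon> : F 0 \<rightarrow> E\<close> and \<open>\<delta> i : F (i + 1) \<rightarrow> F i\<close>.
  Nothing is said about injectivity at \<open>F n\<close>, nor about \<open>F\<close> and \<open>\<delta>\<close> beyond the displayed range.
  \<open>diff_kernel E F \<epsilon> \<delta> i\<close> is the kernel of the map out of \<open>F i\<close>.\<close>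

definition diff_kernel ::
  "('a, 'm) module \<Rightarrow> (nat \<Rightarrow> ('a, 'u) module) \<Rightarrow> ('u \<Rightarrow> 'm) \<Rightarrow> (nat \<Rightarrow> 'u \<Rightarrow> 'u) \<Rightarrow> nat \<Rightarrow> 'u set"
  where
  "diff_kernel E F \<epsilon> \<delta> i =
     (case i of 0 \<Rightarrow> a_kernel (F 0) E \<epsilon> | Suc j \<Rightarrow> a_kernel (F (Suc j)) (F j) (\<delta> j))"

definition aug_exact ::
  "('a, 'r) ring_scheme \<Rightarrow> ('a, 'm) module \<Rightarrow> (nat \<Rightarrow> ('a, 'u) module) \<Rightarrow>
     ('u \<Rightarrow> 'm) \<Rightarrow> (nat \<Rightarrow> 'u \<Rightarrow> 'u) \<Rightarrow> nat \<Rightarrow> bool" where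
  "aug_exact R E F \<epsilon> \<delta> n \<longleftrightarrow>
     module R E \<and> (\<forall>i \<le> n. module R (F i)) \<and>
     \<epsilon> \<in> mod_hom R (F 0) E \<and> (\<forall>i < n. \<delta> i \<in> mod_hom R (F (Suc i)) (F i)) \<and>
     \<epsilon> ` carrier (F 0) = carrier E \<and>
     (\<forall>i < n. \<delta> i ` carrier (F (Suc i)) = diff_kernel E F \<epsilon> \<delta> i)"

text \<open>The carrier type \<open>'a list\<close> is no restriction here: a free module of rank \<open>k\<close> is isomorphic
  to the module of lists of length \<open>k\<close>.\<close>

definition n_presented :: "('a, 'r) ring_scheme \<Rightarrow> nat \<Rightarrow> ('a, 'm) module \<Rightarrow> bool" where
  "n_presented R n E \<longleftrightarrow>
     (\<exists>(F :: nat \<Rightarrow> ('a, 'a list) module) \<epsilon> \<delta>.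
        aug_exact R E F \<epsilon> \<delta> n \<and> (\<forall>i \<le> n. finite_free_module R (F i)))"

text \<open>Existence of an exact sequence \<open>0 \<rightarrow> P d \<rightarrow> \<dots> \<rightarrow> P 0 \<rightarrow> E \<rightarrow> 0\<close> with all \<open>P i\<close> projective.
  The carrier type \<open>('a + 'm) list\<close> is infinite and at least as large as \<open>'a\<close> and \<open>'m\<close>, hence has
  room for the free module on \<open>carrier E\<close>, for the free module on the kernel of its map onto
  \<open>E\<close>, and so on. So if \<open>E\<close> has a projective resolution of length \<open>d\<close> with carriers of any types,
  it has one here: take free \<open>P 0, \<dots>, P (d - 1)\<close> as above and the last kernel, which is
  projective by Schanuel's lemma, as \<open>P d\<close>.\<close>

definition has_projective_resolution ::
  "('a, 'r) ring_scheme \<Rightarrow> ('a, 'm) module \<Rightarrow> nat \<Rightarrow> bool" where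
  "has_projective_resolution R E d \<longleftrightarrow>
     (\<exists>(P :: nat \<Rightarrow> ('a, ('a + 'm) list) module) \<epsilon> \<delta>.
        aug_exact R E P \<epsilon> \<delta> d \<and> (\<forall>i \<le> d. projective_module R (P i)) \<and>
        diff_kernel E P \<epsilon> \<delta> d = {\<zero>\<^bsub>P d\<^esub>})"

text \<open>The infimum of the empty set is \<open>\<infinity>\<close>.\<close>

definition proj_dim :: "('a, 'r) ring_scheme \<Rightarrow> ('a, 'm) module \<Rightarrow> enat" where
  "proj_dim R E = Inf {enat d | d. has_projective_resolution R E d}"

text \<open>An \<open>n\<close>-presented module is finitely generated, hence isomorphic to a quotient of the module
  of lists of some length \<open>k\<close>. The elements of such a quotient are cosets, that is, sets of lists,
  so letting \<open>E\<close> range over modules with carrier type \<open>'a list set\<close> covers all of them.\<close>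

definition nd_ring :: "('a, 'r) ring_scheme \<Rightarrow> nat \<Rightarrow> nat \<Rightarrow> bool" where
  "nd_ring R n d \<longleftrightarrow>
     cring R \<and>
     (\<forall>E :: ('a, 'a list set) module.
        module R E \<and> n_presented R n E \<longrightarrow> proj_dim R E \<le> enat d)"

end

theory Submission
  imports Defs
begin

text \<open>
  (1) A finitely generated submodule \<open>N\<close> of a free module is diagonalised: if \<open>c\<close> is a coordinate of
  some generator \<open>x\<^sub>0\<close> that divides all coordinates of all generators, then subtracting multiples of
  \<open>x\<^sub>0\<close> from the other generators splits \<open>N\<close> as \<open>A x\<^sub>0 \<oplus> N'\<close> with \<open>A x\<^sub>0\<close> isomorphic to
  \<open>A / (0 : c)\<close>. If the syzygies of \<open>N\<close> are finitely generated, then so is their image \<open>(0 : c)\<close>;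
  the hypothesis makes \<open>c\<close> regular, and by induction \<open>N\<close> is free. Applied to the kernel of
  \<open>F 0 \<rightarrow> E\<close> this gives \<open>pd E \<le> 1\<close>.

  (2) If \<open>(0 : a)\<close> is finitely generated, then \<open>(0 : a) = (b)\<close> and \<open>(0 : b) = (a)\<close>. A
  module of finite projective dimension inherits from the ring the property that \<open>a x = 0\<close> implies
  \<open>x \<in> b M\<close>, by descending along a resolution. The module \<open>A / (a)\<close> is 2-presented, via
  multiplication by \<open>a\<close> and \<open>b\<close>, but lacks this property.
\<close>

section \<open>Linear combinations and finite bases\<close>

text \<open>In (1), write \<open>x\<^sub>i = x'\<^sub>i + s\<^sub>i x\<^sub>0\<close>, where the
  coordinate in which \<open>c\<close> occurs vanishes on every \<open>x'\<^sub>i\<close>. This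
  coordinate turns a relation \<open>r\<close> among the generators into
  \<open>(\<Sum> r\<^sub>i s\<^sub>i) c = 0\<close>. Conversely \<open>t c = 0\<close> forces
  \<open>t x\<^sub>0 = 0\<close>, since \<open>c\<close> divides every coordinate of
  \<open>x\<^sub>0\<close>. So \<open>(0 : c)\<close> is the image of the syzygies under one linear
  functional. Once \<open>c\<close> is regular, the functional vanishes on all syzygies, and the
  syzygies of the \<open>x'\<^sub>i\<close> are the restrictions of the old ones: one finitely
  generated module serves the whole induction.

  In (2), passing from a module to an image exchanges \<open>a\<close> and \<open>b\<close>, so both
  orders of the pair are carried down the resolution. The length of the resolution does not enter,
  which excludes every \<open>d\<close> at once. In \<open>A / (a)\<close> the class of 1 is the
  witness: it is killed by \<open>a\<close>, and if it were a multiple of \<open>b\<close>, then 1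
  would lie in \<open>(a) + (b)\<close>, impossible for two comparable proper ideals.\<close>

lemma mod_homI:
  assumes "\<And>x. x \<in> carrier M \<Longrightarrow> f x \<in> carrier N"
    and "\<And>x y. \<lbrakk>x \<in> carrier M; y \<in> carrier M\<rbrakk> \<Longrightarrow> f (x \<oplus>\<^bsub>M\<^esub> y) = f x \<oplus>\<^bsub>N\<^esub> f y"
    and "\<And>a x. \<lbrakk>a \<in> carrier R; x \<in> carrier M\<rbrakk> \<Longrightarrow> f (a \<odot>\<^bsub>M\<^esub> x) = a \<odot>\<^bsub>N\<^esub> f x"
  shows "f \<in> mod_hom R M N"
  using assms by (auto simp: mod_hom_def)

lemma mod_homD:
  assumes "f \<in> mod_hom R M N"
  shows mod_hom_closed: "\<And>x. x \<in> carrier M \<Longrightarrow> f x \<in> carrier N"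
    and mod_hom_add: "\<And>x y. \<lbrakk>x \<in> carrier M; y \<in> carrier M\<rbrakk> \<Longrightarrow> f (x \<oplus>\<^bsub>M\<^esub> y) = f x \<oplus>\<^bsub>N\<^esub> f y"
    and mod_hom_smult: "\<And>a x. \<lbrakk>a \<in> carrier R; x \<in> carrier M\<rbrakk> \<Longrightarrow> f (a \<odot>\<^bsub>M\<^esub> x) = a \<odot>\<^bsub>N\<^esub> f x"
  using assms by (auto simp: mod_hom_def)

lemma mod_hom_comp:
  assumes "f \<in> mod_hom R M N" "g \<in> mod_hom R N P"
  shows "(\<lambda>x. g (f x)) \<in> mod_hom R M P"
  using assms by (auto simp: mod_hom_def Pi_iff)

lemma mod_hom_zero:
  assumes "module R M" "module R N" "f \<in> mod_hom R M N"
  shows "f \<zero>\<^bsub>M\<^esub> = \<zero>\<^bsub>N\<^esub>"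
proof -
  interpret M: module R M by fact
  interpret N: module R N by fact
  have "f \<zero>\<^bsub>M\<^esub> = f (\<zero>\<^bsub>R\<^esub> \<odot>\<^bsub>M\<^esub> \<zero>\<^bsub>M\<^esub>)" by simp
  also have "\<dots> = \<zero>\<^bsub>R\<^esub> \<odot>\<^bsub>N\<^esub> f \<zero>\<^bsub>M\<^esub>"
    by (rule mod_hom_smult[OF assms(3)]) simp_all
  also have "\<dots> = \<zero>\<^bsub>N\<^esub>" using assms(3) by (simp add: mod_hom_closed)
  finally show ?thesis .
qed

lemma (in module) smult_minus_one: "x \<in> carrier M \<Longrightarrow> \<ominus>\<^bsub>M\<^esub> x = (\<ominus> \<one>) \<odot>\<^bsub>M\<^esub> x"
  by (simp add: smult_l_minus)

lemma mod_hom_uminus: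
  assumes "module R M" "module R N" "f \<in> mod_hom R M N" "x \<in> carrier M"
  shows "f (\<ominus>\<^bsub>M\<^esub> x) = \<ominus>\<^bsub>N\<^esub> f x"
proof -
  interpret M: module R M by fact
  interpret N: module R N by fact
  show ?thesis
    using assms(3,4) by (simp add: M.smult_minus_one N.smult_minus_one mod_hom_smult mod_hom_closed)
qed

lemma mod_hom_minus:
  assumes "module R M" "module R N" "f \<in> mod_hom R M N" "x \<in> carrier M" "y \<in> carrier M"
  shows "f (x \<ominus>\<^bsub>M\<^esub> y) = f x \<ominus>\<^bsub>N\<^esub> f y"
proof -
  interpret M: module R M by fact
  interpret N: module R N by fact
  show ?thesis
    using assms by (simp add: a_minus_def mod_hom_add mod_hom_uminus)
qed

lemma mod_hom_finsum:
  assumes "module R M" "module R N" "f \<in> mod_hom R M N" "finite I" "g \<in> I \<rightarrow> carrier M"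
  shows "f (\<Oplus>\<^bsub>M\<^esub>i\<in>I. g i) = (\<Oplus>\<^bsub>N\<^esub>i\<in>I. f (g i))"
  using assms(4,5)
proof (induction I rule: finite_induct)
  case empty
  interpret M: module R M by fact
  interpret N: module R N by fact
  show ?case using mod_hom_zero[OF assms(1-3)] by simp
next
  case (insert x F)
  interpret M: module R M by fact
  interpret N: module R N by fact
  show ?case using insert assms(3)
    by (simp add: Pi_iff mod_hom_add mod_hom_closed)
qed

lemma mod_hom_lincomb:
  assumes "module R M" "module R N" "f \<in> mod_hom R M N" "finite I"
    "x \<in> I \<rightarrow> carrier M" "c \<in> I \<rightarrow> carrier R"
  shows "f (\<Oplus>\<^bsub>M\<^esub>i\<in>I. c i \<odot>\<^bsub>M\<^esub> x i) = (\<Oplus>\<^bsub>N\<^esub>i\<in>I. c i \<odot>\<^bsub>N\<^esub> f (x i))"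
proof -
  interpret M: module R M by fact
  interpret N: module R N by fact
  have "f (\<Oplus>\<^bsub>M\<^esub>i\<in>I. c i \<odot>\<^bsub>M\<^esub> x i) = (\<Oplus>\<^bsub>N\<^esub>i\<in>I. f (c i \<odot>\<^bsub>M\<^esub> x i))"
    by (rule mod_hom_finsum[OF assms(1-4)]) (use assms in \<open>auto simp: Pi_iff\<close>)
  also have "\<dots> = (\<Oplus>\<^bsub>N\<^esub>i\<in>I. c i \<odot>\<^bsub>N\<^esub> f (x i))"
    by (rule N.finsum_cong') (use assms in \<open>auto simp: Pi_iff mod_hom_smult mod_hom_closed\<close>)
  finally show ?thesis .
qed

context module
begin

lemma lincomb_closed:
  "\<lbrakk>c \<in> I \<rightarrow> carrier R; x \<in> I \<rightarrow> carrier M\<rbrakk> \<Longrightarrow> (\<Oplus>\<^bsub>M\<^esub>i\<in>I. c i \<odot>\<^bsub>M\<^esub> x i) \<in> carrier M"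
  by (rule M.finsum_closed) (auto simp: Pi_iff)

lemma lincomb_cong:
  assumes "\<And>i. i \<in> I \<Longrightarrow> c i = c' i" "c' \<in> I \<rightarrow> carrier R" "x \<in> I \<rightarrow> carrier M"
  shows "(\<Oplus>\<^bsub>M\<^esub>i\<in>I. c i \<odot>\<^bsub>M\<^esub> x i) = (\<Oplus>\<^bsub>M\<^esub>i\<in>I. c' i \<odot>\<^bsub>M\<^esub> x i)"
  by (rule M.finsum_cong') (use assms in \<open>auto simp: Pi_iff\<close>)

lemma lincomb_add:
  assumes "c \<in> I \<rightarrow> carrier R" "d \<in> I \<rightarrow> carrier R" "x \<in> I \<rightarrow> carrier M"
  shows "(\<Oplus>\<^bsub>M\<^esub>i\<in>I. (c i \<oplus> d i) \<odot>\<^bsub>M\<^esub> x i) =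
    (\<Oplus>\<^bsub>M\<^esub>i\<in>I. c i \<odot>\<^bsub>M\<^esub> x i) \<oplus>\<^bsub>M\<^esub> (\<Oplus>\<^bsub>M\<^esub>i\<in>I. d i \<odot>\<^bsub>M\<^esub> x i)"
proof -
  have "(\<Oplus>\<^bsub>M\<^esub>i\<in>I. (c i \<oplus> d i) \<odot>\<^bsub>M\<^esub> x i) = (\<Oplus>\<^bsub>M\<^esub>i\<in>I. c i \<odot>\<^bsub>M\<^esub> x i \<oplus>\<^bsub>M\<^esub> d i \<odot>\<^bsub>M\<^esub> x i)"
    by (rule M.finsum_cong') (use assms in \<open>auto simp: Pi_iff smult_l_distr\<close>)
  also have "\<dots> = (\<Oplus>\<^bsub>M\<^esub>i\<in>I. c i \<odot>\<^bsub>M\<^esub> x i) \<oplus>\<^bsub>M\<^esub> (\<Oplus>\<^bsub>M\<^esub>i\<in>I. d i \<odot>\<^bsub>M\<^esub> x i)"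
    by (rule M.finsum_addf) (use assms in \<open>auto simp: Pi_iff\<close>)
  finally show ?thesis .
qed

lemma lincomb_smult:
  assumes "finite I" "a \<in> carrier R" "c \<in> I \<rightarrow> carrier R" "x \<in> I \<rightarrow> carrier M"
  shows "(\<Oplus>\<^bsub>M\<^esub>i\<in>I. (a \<otimes> c i) \<odot>\<^bsub>M\<^esub> x i) = a \<odot>\<^bsub>M\<^esub> (\<Oplus>\<^bsub>M\<^esub>i\<in>I. c i \<odot>\<^bsub>M\<^esub> x i)"
proof -
  have "(\<Oplus>\<^bsub>M\<^esub>i\<in>I. (a \<otimes> c i) \<odot>\<^bsub>M\<^esub> x i) = (\<Oplus>\<^bsub>M\<^esub>i\<in>I. a \<odot>\<^bsub>M\<^esub> (c i \<odot>\<^bsub>M\<^esub> x i))"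
    by (rule M.finsum_cong') (use assms in \<open>auto simp: Pi_iff smult_assoc1\<close>)
  also have "\<dots> = a \<odot>\<^bsub>M\<^esub> (\<Oplus>\<^bsub>M\<^esub>i\<in>I. c i \<odot>\<^bsub>M\<^esub> x i)"
    by (rule finsum_smult_ldistr[symmetric]) (use assms in \<open>auto simp: Pi_iff\<close>)
  finally show ?thesis .
qed

lemma lincomb_single:
  assumes "finite I" "j \<in> I" "x \<in> I \<rightarrow> carrier M" "a \<in> carrier R"
  shows "(\<Oplus>\<^bsub>M\<^esub>i\<in>I. (if i = j then a else \<zero>) \<odot>\<^bsub>M\<^esub> x i) = a \<odot>\<^bsub>M\<^esub> x j"
proof -
  have "(\<Oplus>\<^bsub>M\<^esub>i\<in>I. (if i = j then a else \<zero>) \<odot>\<^bsub>M\<^esub> x i) =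
      (\<Oplus>\<^bsub>M\<^esub>i\<in>I. if j = i then a \<odot>\<^bsub>M\<^esub> x i else \<zero>\<^bsub>M\<^esub>)"
    by (rule M.finsum_cong') (use assms in \<open>auto simp: Pi_iff\<close>)
  also have "\<dots> = a \<odot>\<^bsub>M\<^esub> x j"
    by (rule M.finsum_singleton) (use assms in \<open>auto simp: Pi_iff\<close>)
  finally show ?thesis .
qed

lemma lincomb_insert:
  assumes "finite I" "j \<notin> I" "x \<in> insert j I \<rightarrow> carrier M" "c \<in> insert j I \<rightarrow> carrier R"
  shows "(\<Oplus>\<^bsub>M\<^esub>i\<in>insert j I. c i \<odot>\<^bsub>M\<^esub> x i) = c j \<odot>\<^bsub>M\<^esub> x j \<oplus>\<^bsub>M\<^esub> (\<Oplus>\<^bsub>M\<^esub>i\<in>I. c i \<odot>\<^bsub>M\<^esub> x i)"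
  by (rule M.finsum_insert) (use assms in \<open>auto simp: Pi_iff\<close>)

text \<open>Meant for finite \<open>B\<close>: a \<open>finsum\<close> over an infinite set is zero
  by convention, so over a nontrivial ring no infinite set qualifies.\<close>

definition independent :: "'c set \<Rightarrow> bool" where
  "independent B \<longleftrightarrow> (\<forall>c \<in> B \<rightarrow> carrier R.
     (\<Oplus>\<^bsub>M\<^esub>b\<in>B. c b \<odot>\<^bsub>M\<^esub> b) = \<zero>\<^bsub>M\<^esub> \<longrightarrow> (\<forall>b \<in> B. c b = \<zero>))"

lemma lincomb_support:
  assumes "finite B" "B \<subseteq> carrier M" "c \<in> B \<rightarrow> carrier R"
  shows "(\<Oplus>\<^bsub>M\<^esub>b\<in>{b \<in> B. c b \<noteq> \<zero>}. c b \<odot>\<^bsub>M\<^esub> b) = (\<Oplus>\<^bsub>M\<^esub>b\<in>B. c b \<odot>\<^bsub>M\<^esub> b)"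
  by (rule M.add.finprod_mono_neutral_cong_left) (use assms in \<open>auto simp: Pi_iff subset_iff\<close>)

lemma independent_unique:
  assumes "finite B" "B \<subseteq> carrier M" "independent B" "c \<in> B \<rightarrow> carrier R" "d \<in> B \<rightarrow> carrier R"
    and eq: "(\<Oplus>\<^bsub>M\<^esub>b\<in>B. c b \<odot>\<^bsub>M\<^esub> b) = (\<Oplus>\<^bsub>M\<^esub>b\<in>B. d b \<odot>\<^bsub>M\<^esub> b)" and "b \<in> B"
  shows "c b = d b"
proof -
  let ?e = "\<lambda>b. c b \<oplus> (\<ominus> \<one>) \<otimes> d b"
  have B: "(\<lambda>b. b) \<in> B \<rightarrow> carrier M" using assms by auto
  have e: "?e \<in> B \<rightarrow> carrier R" using assms by (auto simp: Pi_iff)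
  have "(\<Oplus>\<^bsub>M\<^esub>b\<in>B. ?e b \<odot>\<^bsub>M\<^esub> b) =
     (\<Oplus>\<^bsub>M\<^esub>b\<in>B. c b \<odot>\<^bsub>M\<^esub> b) \<oplus>\<^bsub>M\<^esub> (\<Oplus>\<^bsub>M\<^esub>b\<in>B. ((\<ominus> \<one>) \<otimes> d b) \<odot>\<^bsub>M\<^esub> b)"
    by (rule lincomb_add) (use assms B in \<open>auto simp: Pi_iff\<close>)
  also have "(\<Oplus>\<^bsub>M\<^esub>b\<in>B. ((\<ominus> \<one>) \<otimes> d b) \<odot>\<^bsub>M\<^esub> b) = (\<ominus> \<one>) \<odot>\<^bsub>M\<^esub> (\<Oplus>\<^bsub>M\<^esub>b\<in>B. d b \<odot>\<^bsub>M\<^esub> b)"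
    by (rule lincomb_smult) (use assms B in auto)
  also have "(\<Oplus>\<^bsub>M\<^esub>b\<in>B. c b \<odot>\<^bsub>M\<^esub> b) \<oplus>\<^bsub>M\<^esub> \<dots> = \<zero>\<^bsub>M\<^esub>"
    using lincomb_closed[OF assms(5) B] by (simp add: eq smult_l_minus M.r_neg)
  finally have "?e b = \<zero>"
    using bspec[OF assms(3)[unfolded independent_def] e] \<open>b \<in> B\<close> by simp
  moreover have "c b \<in> carrier R" "d b \<in> carrier R" using assms by auto
  ultimately have "c b \<oplus> \<ominus> (d b) = \<zero>" by (simp add: R.l_minus)
  then show ?thesis using \<open>c b \<in> carrier R\<close> \<open>d b \<in> carrier R\<close>
    by (metis R.minus_equality R.minus_minus R.a_inv_closed)
qed

end


text \<open>The coefficient families in \<open>module_basis_def\<close> are total functions, summed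
  over their supports. For finite \<open>B\<close> the sum may be taken over all of
  \<open>B\<close>, and uniqueness of the family becomes independence, the form in which bases are
  built and used below.\<close>

lemma module_basis_finite_iff:
  fixes M :: "('a, 'm) module"
  assumes "module R M" "finite B"
  shows "module_basis R M B \<longleftrightarrow>
    B \<subseteq> carrier M \<and> module.independent R M B \<and>
    (\<forall>x \<in> carrier M. \<exists>c \<in> B \<rightarrow> carrier R. x = (\<Oplus>\<^bsub>M\<^esub>b\<in>B. c b \<odot>\<^bsub>M\<^esub> b))"
    (is "_ \<longleftrightarrow> ?rhs")
proof -
  interpret module R M by fact
  define coeffs where "coeffs x c \<longleftrightarrow>
    (\<forall>b \<in> B. c b \<in> carrier R) \<and> (\<forall>b. b \<notin> B \<longrightarrow> c b = \<zero>\<^bsub>R\<^esub>) \<and>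
    finite {b \<in> B. c b \<noteq> \<zero>\<^bsub>R\<^esub>} \<and>
    x = (\<Oplus>\<^bsub>M\<^esub>b\<in>{b \<in> B. c b \<noteq> \<zero>\<^bsub>R\<^esub>}. c b \<odot>\<^bsub>M\<^esub> b)" for x c
  have basis: "module_basis R M B \<longleftrightarrow> B \<subseteq> carrier M \<and> (\<forall>x \<in> carrier M. \<exists>!c. coeffs x c)"
    unfolding module_basis_def coeffs_def ..
  have coeffs: "coeffs x c \<longleftrightarrow> c \<in> B \<rightarrow> carrier R \<and> (\<forall>b. b \<notin> B \<longrightarrow> c b = \<zero>\<^bsub>R\<^esub>) \<and>
      x = (\<Oplus>\<^bsub>M\<^esub>b\<in>B. c b \<odot>\<^bsub>M\<^esub> b)" if "B \<subseteq> carrier M" for x c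
    using lincomb_support[OF assms(2) that, of c] assms(2) by (auto simp: coeffs_def Pi_iff)
  \<comment> \<open>Uniqueness compares total functions, so a family given on \<open>B\<close>
    becomes a competitor only after extension by zero.\<close>
  define ext where "ext c = (\<lambda>b. if b \<in> B then c b else \<zero>\<^bsub>R\<^esub>)" for c :: "'m \<Rightarrow> 'a"
  have ext: "coeffs (\<Oplus>\<^bsub>M\<^esub>b\<in>B. c b \<odot>\<^bsub>M\<^esub> b) (ext c)"
    if "B \<subseteq> carrier M" "c \<in> B \<rightarrow> carrier R" for c
  proof -
    have "(\<Oplus>\<^bsub>M\<^esub>b\<in>B. ext c b \<odot>\<^bsub>M\<^esub> b) = (\<Oplus>\<^bsub>M\<^esub>b\<in>B. c b \<odot>\<^bsub>M\<^esub> b)"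
      by (rule lincomb_cong) (use that in \<open>auto simp: ext_def\<close>)
    then show ?thesis using that by (auto simp: coeffs ext_def)
  qed
  show ?thesis
  proof
    assume B: "module_basis R M B"
    then have sub: "B \<subseteq> carrier M" by (simp add: basis)
    have "independent B"
      unfolding independent_def
    proof (intro ballI impI)
      fix c b
      assume c: "c \<in> B \<rightarrow> carrier R" and 0: "(\<Oplus>\<^bsub>M\<^esub>b\<in>B. c b \<odot>\<^bsub>M\<^esub> b) = \<zero>\<^bsub>M\<^esub>" and b: "b \<in> B"
      have "(\<Oplus>\<^bsub>M\<^esub>b\<in>B. \<zero>\<^bsub>R\<^esub> \<odot>\<^bsub>M\<^esub> b) = (\<Oplus>\<^bsub>M\<^esub>b\<in>B. \<zero>\<^bsub>M\<^esub>)"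
        by (rule M.finsum_cong') (use sub in auto)
      then have "coeffs \<zero>\<^bsub>M\<^esub> (\<lambda>_. \<zero>\<^bsub>R\<^esub>)" by (simp add: coeffs[OF sub])
      moreover have "coeffs \<zero>\<^bsub>M\<^esub> (ext c)" using ext[OF sub c] 0 by simp
      ultimately have "ext c = (\<lambda>_. \<zero>\<^bsub>R\<^esub>)" using B unfolding basis by blast
      then have "ext c b = \<zero>\<^bsub>R\<^esub>" by simp
      then show "c b = \<zero>\<^bsub>R\<^esub>" using b by (simp add: ext_def)
    qed
    moreover have "\<exists>c \<in> B \<rightarrow> carrier R. x = (\<Oplus>\<^bsub>M\<^esub>b\<in>B. c b \<odot>\<^bsub>M\<^esub> b)" if "x \<in> carrier M" for x
      using B that coeffs[OF sub] unfolding basis by blast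
    ultimately show ?rhs using sub by blast
  next
    assume r: ?rhs
    then have sub: "B \<subseteq> carrier M" by simp
    have "\<exists>!c. coeffs x c" if x: "x \<in> carrier M" for x
    proof -
      obtain c where c: "c \<in> B \<rightarrow> carrier R" "x = (\<Oplus>\<^bsub>M\<^esub>b\<in>B. c b \<odot>\<^bsub>M\<^esub> b)"
        using r x by blast
      have "d = e" if "coeffs x d" "coeffs x e" for d e
      proof
        fix b
        show "d b = e b"
        proof (cases "b \<in> B")
          case True
          show ?thesis
            by (rule independent_unique[OF assms(2) sub _ _ _ _ True])
              (use r that in \<open>auto simp: coeffs[OF sub]\<close>)
        next
          case False
          then show ?thesis using that by (simp add: coeffs[OF sub])
        qed
      qed
      then show ?thesis using ext[OF sub c(1)] c(2) by blast
    qed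
    then show "module_basis R M B" using sub by (simp add: basis)
  qed
qed

text \<open>With the ring as a module, coordinate functions and other functionals become members of
  \<open>mod_hom\<close> and ideals become submodules, so that the lemmas on linear combinations
  also cover sums of products in the ring.\<close>

definition regular_module :: "('a, 'r) ring_scheme \<Rightarrow> ('a, 'a) module" where
  "regular_module R = \<lparr>carrier = carrier R, monoid.mult = monoid.mult R, one = one R,
     ring.zero = ring.zero R, add = add R, smult = monoid.mult R\<rparr>"

lemma regular_module_simps [simp]:
  "carrier (regular_module R) = carrier R"
  "\<zero>\<^bsub>regular_module R\<^esub> = \<zero>\<^bsub>R\<^esub>"
  "x \<oplus>\<^bsub>regular_module R\<^esub> y = x \<oplus>\<^bsub>R\<^esub> y"
  "a \<odot>\<^bsub>regular_module R\<^esub> x = a \<otimes>\<^bsub>R\<^esub> x"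
  "finsum (regular_module R) f I = finsum R f I"
  by (simp_all add: regular_module_def finsum_def finprod_def)

lemma (in cring) regular_module_module: "module R (regular_module R)"
proof (rule moduleI)
  show "abelian_group (regular_module R)"
    by (rule abelian_groupI) (auto simp: a_assoc a_comm a_lcomm intro: l_neg)
qed (auto simp: l_distr r_distr m_assoc cring_axioms)

text \<open>Coefficients with respect to a basis are unique, hence linear in the vector; the map
  replaces each basis element in the expansion by its prescribed value.\<close>

lemma mod_hom_from_basis:
  fixes M :: "('a, 'm) module" and N :: "('a, 'n) module"
  assumes M: "module R M" and N: "module R N" and B: "finite B" "module_basis R M B"
    and t: "t \<in> B \<rightarrow> carrier N"
  shows "\<exists>h \<in> mod_hom R M N. \<forall>b \<in> B. h b = t b"
proof -
  interpret M: module R M by fact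
  interpret N: module R N by fact
  have sub: "B \<subseteq> carrier M" and ind: "M.independent B"
    and span: "\<And>x. x \<in> carrier M \<Longrightarrow> \<exists>c \<in> B \<rightarrow> carrier R. x = (\<Oplus>\<^bsub>M\<^esub>b\<in>B. c b \<odot>\<^bsub>M\<^esub> b)"
    using module_basis_finite_iff[OF M B(1)] B(2) by auto
  have id: "(\<lambda>b. b) \<in> B \<rightarrow> carrier M" using sub by auto
  obtain \<pi> where \<pi>: "\<And>x. x \<in> carrier M \<Longrightarrow> \<pi> x \<in> B \<rightarrow> carrier R"
      "\<And>x. x \<in> carrier M \<Longrightarrow> (\<Oplus>\<^bsub>M\<^esub>b\<in>B. \<pi> x b \<odot>\<^bsub>M\<^esub> b) = x"
    using span by metis
  have uniq: "\<pi> x b = c b"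
    if "x \<in> carrier M" "b \<in> B" "c \<in> B \<rightarrow> carrier R" "(\<Oplus>\<^bsub>M\<^esub>b\<in>B. c b \<odot>\<^bsub>M\<^esub> b) = x" for x c b
    by (rule M.independent_unique[OF B(1) sub ind]) (use \<pi> that in auto)
  have add: "\<pi> (x \<oplus>\<^bsub>M\<^esub> y) b = \<pi> x b \<oplus>\<^bsub>R\<^esub> \<pi> y b"
    if "x \<in> carrier M" "y \<in> carrier M" "b \<in> B" for x y b
    by (rule uniq) (use that \<pi> M.lincomb_add[OF \<pi>(1) \<pi>(1) id] in \<open>auto simp: Pi_iff\<close>)
  have smult: "\<pi> (a \<odot>\<^bsub>M\<^esub> x) b = a \<otimes>\<^bsub>R\<^esub> \<pi> x b"
    if "x \<in> carrier M" "a \<in> carrier R" "b \<in> B" for x a b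
    by (rule uniq) (use that \<pi> M.lincomb_smult[OF B(1) _ \<pi>(1) id] in \<open>auto simp: Pi_iff\<close>)
  define h where "h x = (\<Oplus>\<^bsub>N\<^esub>b\<in>B. \<pi> x b \<odot>\<^bsub>N\<^esub> t b)" for x
  have "h \<in> mod_hom R M N"
  proof (rule mod_homI)
    show "h x \<in> carrier N" if "x \<in> carrier M" for x
      unfolding h_def by (rule N.lincomb_closed[OF \<pi>(1)[OF that] t])
    show "h (x \<oplus>\<^bsub>M\<^esub> y) = h x \<oplus>\<^bsub>N\<^esub> h y" if "x \<in> carrier M" "y \<in> carrier M" for x y
    proof -
      have "h (x \<oplus>\<^bsub>M\<^esub> y) = (\<Oplus>\<^bsub>N\<^esub>b\<in>B. (\<pi> x b \<oplus>\<^bsub>R\<^esub> \<pi> y b) \<odot>\<^bsub>N\<^esub> t b)"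
        unfolding h_def using \<pi>(1)[OF that(1)] \<pi>(1)[OF that(2)]
        by (intro N.lincomb_cong add that t) auto
      also have "\<dots> = h x \<oplus>\<^bsub>N\<^esub> h y"
        unfolding h_def by (intro N.lincomb_add \<pi> that t)
      finally show ?thesis .
    qed
    show "h (a \<odot>\<^bsub>M\<^esub> x) = a \<odot>\<^bsub>N\<^esub> h x" if "a \<in> carrier R" "x \<in> carrier M" for a x
    proof -
      have "h (a \<odot>\<^bsub>M\<^esub> x) = (\<Oplus>\<^bsub>N\<^esub>b\<in>B. (a \<otimes>\<^bsub>R\<^esub> \<pi> x b) \<odot>\<^bsub>N\<^esub> t b)"
        unfolding h_def using \<pi>(1)[OF that(2)] that
        by (intro N.lincomb_cong smult that t) auto
      also have "\<dots> = a \<odot>\<^bsub>N\<^esub> h x"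
        unfolding h_def by (intro N.lincomb_smult \<pi> that t B)
      finally show ?thesis .
    qed
  qed
  moreover have "h b = t b" if b: "b \<in> B" for b
  proof -
    have "\<pi> b b' = (if b' = b then \<one>\<^bsub>R\<^esub> else \<zero>\<^bsub>R\<^esub>)" if "b' \<in> B" for b'
      by (rule uniq) (use that b sub M.lincomb_single[OF B(1) b id, of "\<one>\<^bsub>R\<^esub>"] in auto)
    then have "h b = (\<Oplus>\<^bsub>N\<^esub>b'\<in>B. (if b' = b then \<one>\<^bsub>R\<^esub> else \<zero>\<^bsub>R\<^esub>) \<odot>\<^bsub>N\<^esub> t b')"
      unfolding h_def using t by (intro N.lincomb_cong) auto
    also have "\<dots> = \<one>\<^bsub>R\<^esub> \<odot>\<^bsub>N\<^esub> t b" by (rule N.lincomb_single[OF B(1) b t]) simp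
    finally show ?thesis using t b by (auto simp: Pi_iff)
  qed
  ultimately show ?thesis by blast
qed

text \<open>The functionals are the dual basis, obtained by extending the Kronecker delta
  linearly.\<close>

lemma finite_basis_coordinates:
  fixes M :: "('a, 'm) module"
  assumes M: "module R M" and B: "finite B" "module_basis R M B"
  obtains \<pi> where "\<And>b. b \<in> B \<Longrightarrow> \<pi> b \<in> mod_hom R M (regular_module R)"
    "\<And>x. x \<in> carrier M \<Longrightarrow> x = (\<Oplus>\<^bsub>M\<^esub>b\<in>B. \<pi> b x \<odot>\<^bsub>M\<^esub> b)"
    "\<And>c b. \<lbrakk>c \<in> B \<rightarrow> carrier R; b \<in> B\<rbrakk> \<Longrightarrow> \<pi> b (\<Oplus>\<^bsub>M\<^esub>b\<in>B. c b \<odot>\<^bsub>M\<^esub> b) = c b"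
proof -
  interpret module R M by fact
  have sub: "B \<subseteq> carrier M"
    and span: "\<And>x. x \<in> carrier M \<Longrightarrow> \<exists>c \<in> B \<rightarrow> carrier R. x = (\<Oplus>\<^bsub>M\<^esub>b\<in>B. c b \<odot>\<^bsub>M\<^esub> b)"
    using module_basis_finite_iff[OF M B(1)] B(2) by auto
  have id: "(\<lambda>b. b) \<in> B \<rightarrow> carrier M" using sub by auto
  have "\<exists>h \<in> mod_hom R M (regular_module R). \<forall>b' \<in> B. h b' = (if b' = b then \<one>\<^bsub>R\<^esub> else \<zero>\<^bsub>R\<^esub>)" for b
    by (rule mod_hom_from_basis[OF M regular_module_module B]) auto
  then obtain \<pi> where \<pi>: "\<And>b. \<pi> b \<in> mod_hom R M (regular_module R)"
      "\<And>b b'. b' \<in> B \<Longrightarrow> \<pi> b b' = (if b' = b then \<one>\<^bsub>R\<^esub> else \<zero>\<^bsub>R\<^esub>)"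
    by metis
  interpret reg: module R "regular_module R" by (rule regular_module_module)
  have coord: "\<pi> b (\<Oplus>\<^bsub>M\<^esub>b\<in>B. c b \<odot>\<^bsub>M\<^esub> b) = c b" if c: "c \<in> B \<rightarrow> carrier R" and b: "b \<in> B" for c b
  proof -
    have "\<pi> b (\<Oplus>\<^bsub>M\<^esub>b\<in>B. c b \<odot>\<^bsub>M\<^esub> b) = (\<Oplus>\<^bsub>regular_module R\<^esub>b'\<in>B. c b' \<odot>\<^bsub>regular_module R\<^esub> \<pi> b b')"
      by (rule mod_hom_lincomb[OF M regular_module_module \<pi>(1) B(1) id c])
    also have "\<dots> = (\<Oplus>\<^bsub>regular_module R\<^esub>b'\<in>B. (if b' = b then c b else \<zero>\<^bsub>R\<^esub>) \<odot>\<^bsub>regular_module R\<^esub> \<one>\<^bsub>R\<^esub>)"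
      by (rule reg.M.finsum_cong') (use c b in \<open>auto simp: \<pi>(2) Pi_iff\<close>)
    also have "\<dots> = c b \<odot>\<^bsub>regular_module R\<^esub> \<one>\<^bsub>R\<^esub>"
      by (rule reg.lincomb_single[OF B(1) b]) (use c b in auto)
    finally show ?thesis using c b by (auto simp: Pi_iff)
  qed
  show thesis
  proof (rule that[of \<pi>])
    show "\<pi> b \<in> mod_hom R M (regular_module R)" for b by (rule \<pi>)
    show "x = (\<Oplus>\<^bsub>M\<^esub>b\<in>B. \<pi> b x \<odot>\<^bsub>M\<^esub> b)" if x: "x \<in> carrier M" for x
    proof -
      obtain c where c: "c \<in> B \<rightarrow> carrier R" "x = (\<Oplus>\<^bsub>M\<^esub>b\<in>B. c b \<odot>\<^bsub>M\<^esub> b)"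
        using span[OF x] by blast
      have "(\<Oplus>\<^bsub>M\<^esub>b\<in>B. \<pi> b x \<odot>\<^bsub>M\<^esub> b) = (\<Oplus>\<^bsub>M\<^esub>b\<in>B. c b \<odot>\<^bsub>M\<^esub> b)"
        by (rule lincomb_cong) (use coord[OF c(1)] c sub in auto)
      then show ?thesis using c(2) by simp
    qed
    show "\<pi> b (\<Oplus>\<^bsub>M\<^esub>b\<in>B. c b \<odot>\<^bsub>M\<^esub> b) = c b" if "c \<in> B \<rightarrow> carrier R" "b \<in> B" for c b
      using coord that .
  qed
qed

text \<open>Preimages are chosen on the basis only; the composite then agrees with \<open>f\<close>
  on the basis, hence everywhere. The carrier types of \<open>M\<close> and \<open>N\<close> are
  unrelated to that of \<open>P\<close>, as is required when a free module is copied into another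
  type.\<close>

lemma finite_basis_lifting:
  fixes P :: "('a, 'p) module" and M :: "('a, 'm) module" and N :: "('a, 'n) module"
  assumes P: "finite_free_module R P" and M: "module R M" and N: "module R N"
    and g: "g \<in> mod_hom R M N" "g ` carrier M = carrier N" and f: "f \<in> mod_hom R P N"
  shows "\<exists>h \<in> mod_hom R P M. \<forall>x \<in> carrier P. g (h x) = f x"
proof -
  obtain B where mP: "module R P" and B: "finite B" "module_basis R P B"
    using P by (auto simp: finite_free_module_def)
  interpret P: module R P by fact
  interpret M: module R M by fact
  interpret N: module R N by fact
  have sub: "B \<subseteq> carrier P"
    and span: "\<And>x. x \<in> carrier P \<Longrightarrow> \<exists>c \<in> B \<rightarrow> carrier R. x = (\<Oplus>\<^bsub>P\<^esub>b\<in>B. c b \<odot>\<^bsub>P\<^esub> b)"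
    using module_basis_finite_iff[OF mP B(1)] B(2) by auto
  have id: "(\<lambda>b. b) \<in> B \<rightarrow> carrier P" using sub by auto
  have "\<forall>b \<in> B. \<exists>m \<in> carrier M. g m = f b"
    using sub mod_hom_closed[OF f] g(2) by (metis imageE subsetD)
  then obtain t where t: "t \<in> B \<rightarrow> carrier M" "\<And>b. b \<in> B \<Longrightarrow> g (t b) = f b"
    by (metis Pi_I)
  obtain h where h: "h \<in> mod_hom R P M" "\<And>b. b \<in> B \<Longrightarrow> h b = t b"
    using mod_hom_from_basis[OF mP M B t(1)] by blast
  have "g (h x) = f x" if "x \<in> carrier P" for x
  proof -
    obtain c where c: "c \<in> B \<rightarrow> carrier R" "x = (\<Oplus>\<^bsub>P\<^esub>b\<in>B. c b \<odot>\<^bsub>P\<^esub> b)"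
      using span[OF \<open>x \<in> carrier P\<close>] by blast
    have "g (h x) = (\<Oplus>\<^bsub>N\<^esub>b\<in>B. c b \<odot>\<^bsub>N\<^esub> g (h b))" unfolding c(2)
      by (rule mod_hom_lincomb[OF mP N mod_hom_comp[OF h(1) g(1)] B(1) id c(1)])
    also have "\<dots> = (\<Oplus>\<^bsub>N\<^esub>b\<in>B. c b \<odot>\<^bsub>N\<^esub> f b)"
      by (rule N.finsum_cong') (use c sub t h mod_hom_closed[OF f] in \<open>auto simp: Pi_iff subset_iff\<close>)
    also have "\<dots> = f x" unfolding c(2)
      by (rule mod_hom_lincomb[OF mP N f B(1) id c(1), symmetric])
    finally show ?thesis .
  qed
  then show ?thesis using h(1) by blast
qed

section \<open>Submodules, ideals and images of functionals\<close>

lemma (in module) submodule_lincomb: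
  assumes H: "submodule H R M" and "finite I" "x \<in> I \<rightarrow> H" "c \<in> I \<rightarrow> carrier R"
  shows "(\<Oplus>\<^bsub>M\<^esub>i\<in>I. c i \<odot>\<^bsub>M\<^esub> x i) \<in> H"
  using assms(2-4)
proof (induction I rule: finite_induct)
  case empty
  show ?case using subgroup.one_closed[OF submodule.axioms(1)[OF H]] by simp
next
  case (insert j I)
  have "x \<in> insert j I \<rightarrow> carrier M"
    using insert.prems(1) submoduleE(1)[OF H] by auto
  with insert show ?case
    by (simp add: lincomb_insert Pi_iff submoduleE(4,5)[OF H])
qed

lemma kernel_submodule:
  assumes M: "module R M" and N: "module R N" and f: "f \<in> mod_hom R M N"
  shows "submodule (a_kernel M N f) R M"
proof -
  interpret M: module R M by fact
  interpret N: module R N by fact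
  show ?thesis
    by (rule M.submoduleI)
      (auto simp: a_kernel_def' mod_hom_zero[OF M N f] mod_hom_uminus[OF M N f]
        mod_hom_add[OF f] mod_hom_smult[OF f])
qed

lemma ideal_submodule:
  assumes "cring R" "ideal I R"
  shows "submodule I R (regular_module R)"
proof -
  interpret cring R by fact
  interpret ideal I R by fact
  interpret reg: module R "regular_module R" by (rule regular_module_module)
  have inv: "\<ominus>\<^bsub>regular_module R\<^esub> a = \<ominus>\<^bsub>R\<^esub> a" if "a \<in> carrier R" for a
    using that by (simp add: reg.smult_minus_one l_minus)
  show ?thesis
    by (rule reg.submoduleI) (use inv in \<open>auto simp: I_l_closed a_subset[THEN subsetD]\<close>)
qed

text \<open>The image of a functional is an ideal generated by the values at the generators
  \<open>T\<close>. In this way a finitely generated module of relations makes an annihilator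
  finitely generated.\<close>

lemma fg_ideal_functional_image:
  fixes G :: "('a, 'g) module"
  assumes G: "module R G" and T: "finite T" "T \<subseteq> carrier G"
    and span: "\<And>g. g \<in> carrier G \<Longrightarrow> \<exists>c \<in> T \<rightarrow> carrier R. g = (\<Oplus>\<^bsub>G\<^esub>t\<in>T. c t \<odot>\<^bsub>G\<^esub> t)"
    and l: "l \<in> mod_hom R G (regular_module R)"
  shows "fg_ideal R (l ` carrier G)"
proof -
  interpret G: module R G by fact
  interpret reg: module R "regular_module R" by (rule G.regular_module_module)
  have lc: "l g \<in> carrier R" if "g \<in> carrier G" for g using mod_hom_closed[OF l that] by simp
  have lT: "l ` T \<subseteq> carrier R" using lc T by auto
  have id: "(\<lambda>t. t) \<in> T \<rightarrow> carrier G" using T by auto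
  have inv: "\<ominus>\<^bsub>R\<^esub> u \<in> l ` carrier G" if u: "u \<in> l ` carrier G" for u
  proof -
    obtain g where g: "g \<in> carrier G" "u = l g" using u by blast
    have "l (\<ominus>\<^bsub>G\<^esub> g) = \<ominus>\<^bsub>R\<^esub> u"
      using g lc by (simp add: G.smult_minus_one mod_hom_smult[OF l] G.R.l_minus)
    then show ?thesis using g G.M.a_inv_closed[of g] by (metis imageI)
  qed
  have add: "u \<oplus>\<^bsub>R\<^esub> v \<in> l ` carrier G" if u: "u \<in> l ` carrier G" and v: "v \<in> l ` carrier G" for u v
  proof -
    obtain g where g: "g \<in> carrier G" "u = l g" using u by blast
    obtain h where h: "h \<in> carrier G" "v = l h" using v by blast
    from g h have "u \<oplus>\<^bsub>R\<^esub> v = l (g \<oplus>\<^bsub>G\<^esub> h)" "g \<oplus>\<^bsub>G\<^esub> h \<in> carrier G"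
      by (simp_all add: mod_hom_add[OF l])
    then show ?thesis by simp
  qed
  have "subgroup (l ` carrier G) (add_monoid R)"
    by (rule G.R.add.subgroupI) (use lc inv add in \<open>auto simp: a_inv_def\<close>)
  then have "ideal (l ` carrier G) R"
  proof (rule idealI[OF G.R.ring_axioms])
    fix u a assume "u \<in> l ` carrier G" and a: "a \<in> carrier R"
    then obtain g where g: "g \<in> carrier G" "u = l g" by blast
    have eq: "l (a \<odot>\<^bsub>G\<^esub> g) = a \<otimes>\<^bsub>R\<^esub> u" using g a by (simp add: mod_hom_smult[OF l])
    show 1: "a \<otimes>\<^bsub>R\<^esub> u \<in> l ` carrier G"
      by (rule image_eqI, rule eq[symmetric]) (use g a in simp)
    show "u \<otimes>\<^bsub>R\<^esub> a \<in> l ` carrier G" using 1 g a lc by (simp add: G.R.m_comm)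
  qed
  then have "Idl\<^bsub>R\<^esub> (l ` T) \<subseteq> l ` carrier G"
    using T by (intro G.R.genideal_minimal) auto
  moreover have "l ` carrier G \<subseteq> Idl\<^bsub>R\<^esub> (l ` T)"
  proof
    fix u assume "u \<in> l ` carrier G"
    then obtain g where g: "g \<in> carrier G" "u = l g" by blast
    then obtain c where c: "c \<in> T \<rightarrow> carrier R" "g = (\<Oplus>\<^bsub>G\<^esub>t\<in>T. c t \<odot>\<^bsub>G\<^esub> t)"
      using span by blast
    have "u = (\<Oplus>\<^bsub>regular_module R\<^esub>t\<in>T. c t \<odot>\<^bsub>regular_module R\<^esub> l t)"
      unfolding g(2) c(2) by (rule mod_hom_lincomb[OF G G.regular_module_module l T(1) id c(1)])
    also have "\<dots> \<in> Idl\<^bsub>R\<^esub> (l ` T)"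
      by (rule reg.submodule_lincomb[OF ideal_submodule[OF G.R.is_cring G.R.genideal_ideal[OF lT]] T(1) _ c(1)])
        (use G.R.genideal_self[OF lT] in auto)
    finally show "u \<in> Idl\<^bsub>R\<^esub> (l ` T)" .
  qed
  ultimately show ?thesis using lT T(1) unfolding fg_ideal_def by blast
qed

section \<open>Finitely presented submodules over valuation rings\<close>

lemma valuation_ring_dvd_cases:
  assumes "valuation_ring R" "x \<in> carrier R" "y \<in> carrier R"
  obtains s where "s \<in> carrier R" "x = s \<otimes>\<^bsub>R\<^esub> y" | s where "s \<in> carrier R" "y = s \<otimes>\<^bsub>R\<^esub> x"
proof -
  interpret cring R using assms(1) by (simp add: valuation_ring_def)
  have "PIdl\<^bsub>R\<^esub> x \<subseteq> PIdl\<^bsub>R\<^esub> y \<or> PIdl\<^bsub>R\<^esub> y \<subseteq> PIdl\<^bsub>R\<^esub> x"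
    using assms cgenideal_ideal by (simp add: valuation_ring_def)
  then have "x \<in> PIdl\<^bsub>R\<^esub> y \<or> y \<in> PIdl\<^bsub>R\<^esub> x"
    using assms cgenideal_self by blast
  then show thesis using that by (auto simp: cgenideal_def)
qed

text \<open>Divisibility is total here: the divisor found for \<open>C\<close> and a new element
  \<open>x\<close> are comparable, and by transitivity one of them divides everything.\<close>

lemma valuation_ring_finite_divisor:
  assumes R: "valuation_ring R" and "finite C" "C \<noteq> {}" "C \<subseteq> carrier R"
  shows "\<exists>c \<in> C. \<forall>x \<in> C. \<exists>s \<in> carrier R. x = s \<otimes>\<^bsub>R\<^esub> c"
  using assms(2-4)
proof (induction C rule: finite_ne_induct)
  interpret cring R using assms(1) by (simp add: valuation_ring_def)
  {
    case (singleton x)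
    then show ?case by (auto intro!: bexI[of _ "\<one>\<^bsub>R\<^esub>"])
  next
    case (insert x C)
    then obtain c where c: "c \<in> C" "\<And>y. y \<in> C \<Longrightarrow> \<exists>s \<in> carrier R. y = s \<otimes>\<^bsub>R\<^esub> c" by auto
    have xc: "x \<in> carrier R" "c \<in> carrier R" using insert.prems c by auto
    from R xc show ?case
    proof (cases rule: valuation_ring_dvd_cases)
      case (1 s)
      then show ?thesis using c by auto
    next
      case (2 s)
      have "\<exists>t \<in> carrier R. y = t \<otimes>\<^bsub>R\<^esub> x" if "y \<in> insert x C" for y
      proof (cases "y = x")
        case True
        then show ?thesis using xc by (auto intro!: bexI[of _ "\<one>\<^bsub>R\<^esub>"])
      next
        case False
        then have "y \<in> C" using that by simp
        then obtain t where t: "t \<in> carrier R" "y = t \<otimes>\<^bsub>R\<^esub> c" using c(2) by blast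
        then have "y = (t \<otimes>\<^bsub>R\<^esub> s) \<otimes>\<^bsub>R\<^esub> x" using 2 xc by (simp add: m_assoc)
        then show ?thesis using t 2 by blast
      qed
      then show ?thesis by blast
    qed
  }
qed

lemma (in module) finsum_smult_rdistr:
  assumes "finite I" "a \<in> I \<rightarrow> carrier R" "y \<in> carrier M"
  shows "(\<Oplus>i\<in>I. a i) \<odot>\<^bsub>M\<^esub> y = (\<Oplus>\<^bsub>M\<^esub>i\<in>I. a i \<odot>\<^bsub>M\<^esub> y)"
  using assms(1,2)
proof (induction I rule: finite_induct)
  case (insert j I)
  then show ?case using assms(3)
    by (simp add: Pi_iff smult_l_distr)
qed (use assms in simp)

text \<open>The finitely generated module \<open>G\<close> parametrises the syzygies of the generators \<open>x\<close>. That
  \<open>x\<close> and \<open>B\<close> span the same submodule is expressed by quantifying over all submodules \<open>H\<close>, so that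
  no linear combinations have to be rewritten when the generators change.\<close>

lemma finitely_presented_submodule_basis:
  fixes F :: "('a, 'm) module" and G :: "('a, 'g) module" and x :: "'i \<Rightarrow> 'm"
  assumes R: "valuation_ring R"
    and ann: "\<And>a. a \<in> zero_divisors R - {\<zero>\<^bsub>R\<^esub>} \<Longrightarrow> \<not> fg_ideal R (ann R a)"
    and F: "module R F" and G: "module R G"
    and T: "finite T" "T \<subseteq> carrier G"
      "\<And>g. g \<in> carrier G \<Longrightarrow> \<exists>c \<in> T \<rightarrow> carrier R. g = (\<Oplus>\<^bsub>G\<^esub>t\<in>T. c t \<odot>\<^bsub>G\<^esub> t)"
    and \<Phi>: "finite \<Phi>" "\<Phi> \<subseteq> mod_hom R F (regular_module R)"
      "\<And>y. \<lbrakk>y \<in> carrier F; \<And>\<pi>. \<pi> \<in> \<Phi> \<Longrightarrow> \<pi> y = \<zero>\<^bsub>R\<^esub>\<rbrakk> \<Longrightarrow> y = \<zero>\<^bsub>F\<^esub>"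
    and I: "finite I" "x \<in> I \<rightarrow> carrier F" "\<sigma> \<in> I \<rightarrow> mod_hom R G (regular_module R)"
    and syz: "\<And>r. r \<in> I \<rightarrow> carrier R \<Longrightarrow>
      (\<Oplus>\<^bsub>F\<^esub>i\<in>I. r i \<odot>\<^bsub>F\<^esub> x i) = \<zero>\<^bsub>F\<^esub> \<longleftrightarrow> (\<exists>g \<in> carrier G. \<forall>i \<in> I. r i = \<sigma> i g)"
  shows "\<exists>B. finite B \<and> B \<subseteq> carrier F \<and> module.independent R F B \<and>
    (\<forall>H. submodule H R F \<longrightarrow> x ` I \<subseteq> H \<longleftrightarrow> B \<subseteq> H)"
  using I syz
proof (induction I arbitrary: x rule: finite_psubset_induct)
  case (psubset I)
  note I = \<open>finite I\<close> and x = psubset.prems(1) and \<sigma> = psubset.prems(2) and syz = psubset.prems(3)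
  interpret F: module R F by fact
  interpret G: module R G by fact
  interpret reg: module R "regular_module R" by (rule F.regular_module_module)
  have xc: "x i \<in> carrier F" if "i \<in> I" for i using x that by auto
  have \<pi>c: "\<pi> y \<in> carrier R" if "\<pi> \<in> \<Phi>" "y \<in> carrier F" for \<pi> y
    using mod_hom_closed[of \<pi> R F "regular_module R" y] \<Phi>(2) that by auto
  have \<sigma>c: "\<sigma> i g \<in> carrier R" if "i \<in> I" "g \<in> carrier G" for i g
    using mod_hom_closed[of "\<sigma> i" R G "regular_module R" g] \<sigma> that by auto
  show ?case
  proof (cases "\<forall>\<pi> \<in> \<Phi>. \<forall>i \<in> I. \<pi> (x i) = \<zero>\<^bsub>R\<^esub>")
    case True
    \<comment> \<open>\<open>\<Phi>\<close> separates points, so all generators vanish and the empty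
      set is a basis of their span. This includes \<open>I = {}\<close>, where the induction
      ends.\<close>
    then have "x i = \<zero>\<^bsub>F\<^esub>" if "i \<in> I" for i using \<Phi>(3) xc that by blast
    moreover have "\<zero>\<^bsub>F\<^esub> \<in> H" if "submodule H R F" for H
      using subgroup.one_closed[OF submodule.axioms(1)[OF that]] by simp
    ultimately show ?thesis by (intro exI[of _ "{}"]) (auto simp: F.independent_def)
  next
    case False
    \<comment> \<open>All coordinates of all generators. One that divides the others becomes the
      pivot \<open>c\<close>, the value of \<open>\<pi>\<close> at \<open>x j\<close>.\<close>
    define C where "C = (\<lambda>(\<pi>, i). \<pi> (x i)) ` (\<Phi> \<times> I)"
    have CI: "\<rho> (x i) \<in> C" if "\<rho> \<in> \<Phi>" "i \<in> I" for \<rho> i using that by (force simp: C_def)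
    have "finite C" "C \<noteq> {}" "C \<subseteq> carrier R"
      using False I \<Phi>(1) \<pi>c xc by (auto simp: C_def)
    from valuation_ring_finite_divisor[OF R this]
    obtain c where "c \<in> C" and div: "\<And>y. y \<in> C \<Longrightarrow> \<exists>s \<in> carrier R. y = s \<otimes>\<^bsub>R\<^esub> c" by blast
    then obtain \<pi> j where \<pi>: "\<pi> \<in> \<Phi>" and j: "j \<in> I" and c: "c = \<pi> (x j)"
      by (auto simp: C_def)
    have cc: "c \<in> carrier R" using c \<pi> j \<pi>c xc by simp
    have c0: "c \<noteq> \<zero>\<^bsub>R\<^esub>"
    proof
      assume "c = \<zero>\<^bsub>R\<^esub>"
      then have "y = \<zero>\<^bsub>R\<^esub>" if "y \<in> C" for y using div[OF that] by auto
      then show False using False CI by blast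
    qed
    have \<pi>h: "\<pi> \<in> mod_hom R F (regular_module R)" using \<pi> \<Phi>(2) by blast
    \<comment> \<open>Quotients by \<open>c\<close> need not be unique while \<open>c\<close> may
      still be a zero divisor, so the value \<open>\<one>\<close> at \<open>j\<close> is demanded
      explicitly; it makes \<open>x' j\<close> vanish.\<close>
    have "\<forall>i \<in> I. \<exists>s \<in> carrier R. \<pi> (x i) = s \<otimes>\<^bsub>R\<^esub> c \<and> (i = j \<longrightarrow> s = \<one>\<^bsub>R\<^esub>)"
    proof
      fix i assume "i \<in> I"
      show "\<exists>s \<in> carrier R. \<pi> (x i) = s \<otimes>\<^bsub>R\<^esub> c \<and> (i = j \<longrightarrow> s = \<one>\<^bsub>R\<^esub>)"
      proof (cases "i = j")
        case True
        then show ?thesis using cc c by auto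
      next
        case False
        then show ?thesis using div[OF CI[OF \<pi> \<open>i \<in> I\<close>]] by simp
      qed
    qed
    then obtain s where s: "s \<in> I \<rightarrow> carrier R" "\<And>i. i \<in> I \<Longrightarrow> \<pi> (x i) = s i \<otimes>\<^bsub>R\<^esub> c" "s j = \<one>\<^bsub>R\<^esub>"
      using j unfolding Pi_iff by metis
    have sc: "s i \<in> carrier R" if "i \<in> I" for i using s that by auto
    have \<sigma>h: "\<sigma> i \<in> mod_hom R G (regular_module R)" if "i \<in> I" for i using \<sigma> that by auto
    define x' where "x' i = x i \<ominus>\<^bsub>F\<^esub> s i \<odot>\<^bsub>F\<^esub> x j" for i
    define I' where "I' = I - {j}"
    have I': "I' \<subset> I" "finite I'" "j \<notin> I'" "I = insert j I'" "\<And>i. i \<in> I' \<Longrightarrow> i \<in> I"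
      using j I by (auto simp: I'_def)
    have x'c: "x' i \<in> carrier F" if "i \<in> I" for i using that xc sc j by (simp add: x'_def)
    have xx': "x i = x' i \<oplus>\<^bsub>F\<^esub> s i \<odot>\<^bsub>F\<^esub> x j" if "i \<in> I" for i
      using that xc sc j by (simp add: x'_def a_minus_def F.M.a_assoc F.M.l_neg)
    have x'j: "x' j = \<zero>\<^bsub>F\<^esub>" using s(3) xc[OF j] by (simp add: x'_def F.M.r_neg a_minus_def)
    have \<pi>x': "\<pi> (x' i) = \<zero>\<^bsub>R\<^esub>" if "i \<in> I" for i
    proof -
      have "s i \<otimes>\<^bsub>R\<^esub> c = \<pi> (x' i) \<oplus>\<^bsub>R\<^esub> s i \<otimes>\<^bsub>R\<^esub> c"
        using that xc x'c sc j s(2)[OF that] xx'[OF that] mod_hom_add[OF \<pi>h, of "x' i" "s i \<odot>\<^bsub>F\<^esub> x j"]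
        by (simp add: mod_hom_smult[OF \<pi>h] c)
      then show ?thesis using \<pi>c[OF \<pi> x'c[OF that]] sc[OF that] cc
        by (metis F.R.add.l_cancel_one' F.R.m_closed F.R.add.m_comm)
    qed
    let ?K = "a_kernel F (regular_module R) \<pi>"
    have K: "submodule ?K R F" by (rule kernel_submodule[OF F F.regular_module_module \<pi>h])
    have x'K: "x' ` I' \<subseteq> ?K" using x'c \<pi>x' I' by (auto simp: a_kernel_def')
    \<comment> \<open>Every combination splits into a part in the kernel of \<open>\<pi>\<close> and
      a multiple of the pivot generator \<open>x j\<close>.\<close>
    have decomp: "(\<Oplus>\<^bsub>F\<^esub>i\<in>I. r i \<odot>\<^bsub>F\<^esub> x i) =
        (\<Oplus>\<^bsub>F\<^esub>i\<in>I'. r i \<odot>\<^bsub>F\<^esub> x' i) \<oplus>\<^bsub>F\<^esub> (\<Oplus>\<^bsub>R\<^esub>i\<in>I. r i \<otimes>\<^bsub>R\<^esub> s i) \<odot>\<^bsub>F\<^esub> x j"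
      if r: "r \<in> I \<rightarrow> carrier R" for r
    proof -
      have "(\<Oplus>\<^bsub>F\<^esub>i\<in>I. r i \<odot>\<^bsub>F\<^esub> x i) =
          (\<Oplus>\<^bsub>F\<^esub>i\<in>I. r i \<odot>\<^bsub>F\<^esub> x' i \<oplus>\<^bsub>F\<^esub> (r i \<otimes>\<^bsub>R\<^esub> s i) \<odot>\<^bsub>F\<^esub> x j)"
      proof (rule F.M.finsum_cong')
        fix i assume i: "i \<in> I"
        have ri: "r i \<in> carrier R" using r i by auto
        show "r i \<odot>\<^bsub>F\<^esub> x i = r i \<odot>\<^bsub>F\<^esub> x' i \<oplus>\<^bsub>F\<^esub> (r i \<otimes>\<^bsub>R\<^esub> s i) \<odot>\<^bsub>F\<^esub> x j"
          by (subst xx'[OF i]) (use ri i j x'c xc sc in \<open>simp add: F.smult_r_distr F.smult_assoc1\<close>)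
      qed (use r j x'c xc sc in \<open>auto simp: Pi_iff\<close>)
      also have "\<dots> = (\<Oplus>\<^bsub>F\<^esub>i\<in>I. r i \<odot>\<^bsub>F\<^esub> x' i) \<oplus>\<^bsub>F\<^esub> (\<Oplus>\<^bsub>F\<^esub>i\<in>I. (r i \<otimes>\<^bsub>R\<^esub> s i) \<odot>\<^bsub>F\<^esub> x j)"
        by (rule F.M.finsum_addf) (use r j x'c xc sc in \<open>auto simp: Pi_iff\<close>)
      also have "(\<Oplus>\<^bsub>F\<^esub>i\<in>I. (r i \<otimes>\<^bsub>R\<^esub> s i) \<odot>\<^bsub>F\<^esub> x j) = (\<Oplus>\<^bsub>R\<^esub>i\<in>I. r i \<otimes>\<^bsub>R\<^esub> s i) \<odot>\<^bsub>F\<^esub> x j"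
        by (rule F.finsum_smult_rdistr[symmetric]) (use I r j xc sc in \<open>auto simp: Pi_iff\<close>)
      also have "(\<Oplus>\<^bsub>F\<^esub>i\<in>I. r i \<odot>\<^bsub>F\<^esub> x' i) = r j \<odot>\<^bsub>F\<^esub> x' j \<oplus>\<^bsub>F\<^esub> (\<Oplus>\<^bsub>F\<^esub>i\<in>I'. r i \<odot>\<^bsub>F\<^esub> x' i)"
        unfolding I'(4) by (rule F.lincomb_insert) (use I' r x'c in auto)
      also have "\<dots> = (\<Oplus>\<^bsub>F\<^esub>i\<in>I'. r i \<odot>\<^bsub>F\<^esub> x' i)"
        using r j F.lincomb_closed[of r I' x'] x'c I' by (auto simp: x'j Pi_iff)
      finally show ?thesis .
    qed
    have x'lin: "(\<Oplus>\<^bsub>F\<^esub>i\<in>I'. r i \<odot>\<^bsub>F\<^esub> x' i) \<in> ?K" if "r \<in> I' \<rightarrow> carrier R" for r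
      by (rule F.submodule_lincomb[OF K]) (use I' x'K that in auto)
    have x'lin_c: "(\<Oplus>\<^bsub>F\<^esub>i\<in>I'. r i \<odot>\<^bsub>F\<^esub> x' i) \<in> carrier F" if "r \<in> I' \<rightarrow> carrier R" for r
      using x'lin[OF that] by (simp add: a_kernel_def')
    \<comment> \<open>The coefficient of \<open>x j\<close> in \<open>decomp\<close> for the syzygy
      belonging to \<open>g\<close>. Applying \<open>\<pi>\<close> to that syzygy leaves
      \<open>l g \<otimes> c = \<zero>\<close>.\<close>
    define l where "l g = (\<Oplus>\<^bsub>R\<^esub>i\<in>I. \<sigma> i g \<otimes>\<^bsub>R\<^esub> s i)" for g
    have rs_c: "(\<Oplus>\<^bsub>R\<^esub>i\<in>I. r i \<otimes>\<^bsub>R\<^esub> s i) \<in> carrier R" if "r \<in> I \<rightarrow> carrier R" for r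
      using reg.lincomb_closed[of r I s] s that by simp
    have l_reg: "l g = (\<Oplus>\<^bsub>regular_module R\<^esub>i\<in>I. \<sigma> i g \<odot>\<^bsub>regular_module R\<^esub> s i)" for g
      by (simp add: l_def)
    have l: "l \<in> mod_hom R G (regular_module R)"
    proof (rule mod_homI)
      show "l g \<in> carrier (regular_module R)" if "g \<in> carrier G" for g
        using rs_c[of "\<lambda>i. \<sigma> i g"] \<sigma>c that by (simp add: l_def)
      show "l (g \<oplus>\<^bsub>G\<^esub> h) = l g \<oplus>\<^bsub>regular_module R\<^esub> l h" if "g \<in> carrier G" "h \<in> carrier G" for g h
      proof -
        have "l (g \<oplus>\<^bsub>G\<^esub> h) = (\<Oplus>\<^bsub>regular_module R\<^esub>i\<in>I. (\<sigma> i g \<oplus>\<^bsub>R\<^esub> \<sigma> i h) \<odot>\<^bsub>regular_module R\<^esub> s i)"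
          unfolding l_reg
          by (rule reg.lincomb_cong) (use that \<sigma>c s(1) mod_hom_add[OF \<sigma>h] in auto)
        also have "\<dots> = l g \<oplus>\<^bsub>regular_module R\<^esub> l h"
          unfolding l_reg
          by (rule reg.lincomb_add) (use that \<sigma>c s in auto)
        finally show ?thesis .
      qed
      show "l (a \<odot>\<^bsub>G\<^esub> g) = a \<odot>\<^bsub>regular_module R\<^esub> l g" if "a \<in> carrier R" "g \<in> carrier G" for a g
      proof -
        have eq: "l (a \<odot>\<^bsub>G\<^esub> g) = (\<Oplus>\<^bsub>regular_module R\<^esub>i\<in>I. (a \<otimes>\<^bsub>R\<^esub> \<sigma> i g) \<odot>\<^bsub>regular_module R\<^esub> s i)"
          unfolding l_reg
          by (rule reg.lincomb_cong) (use that \<sigma>c s(1) mod_hom_smult[OF \<sigma>h] in auto)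
        also have "\<dots> = a \<odot>\<^bsub>regular_module R\<^esub> l g"
          unfolding l_reg
          by (subst reg.lincomb_smult) (use that I \<sigma>c s in auto)
        finally show ?thesis .
      qed
    qed
    have annl: "l g \<otimes>\<^bsub>R\<^esub> c = \<zero>\<^bsub>R\<^esub>" if g: "g \<in> carrier G" for g
    proof -
      let ?r = "\<lambda>i. \<sigma> i g"
      have r: "?r \<in> I \<rightarrow> carrier R" using \<sigma>c g by auto
      have r': "?r \<in> I' \<rightarrow> carrier R" using r I' by auto
      have "(\<Oplus>\<^bsub>F\<^esub>i\<in>I. ?r i \<odot>\<^bsub>F\<^esub> x i) = \<zero>\<^bsub>F\<^esub>" using syz[OF r] g by blast
      then have "\<zero>\<^bsub>F\<^esub> = (\<Oplus>\<^bsub>F\<^esub>i\<in>I'. ?r i \<odot>\<^bsub>F\<^esub> x' i) \<oplus>\<^bsub>F\<^esub> l g \<odot>\<^bsub>F\<^esub> x j"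
        using decomp[OF r] by (simp add: l_def)
      then have "\<pi> \<zero>\<^bsub>F\<^esub> = \<pi> (\<Oplus>\<^bsub>F\<^esub>i\<in>I'. ?r i \<odot>\<^bsub>F\<^esub> x' i) \<oplus>\<^bsub>R\<^esub> l g \<otimes>\<^bsub>R\<^esub> c"
        using mod_hom_add[OF \<pi>h x'lin_c[OF r'], of "l g \<odot>\<^bsub>F\<^esub> x j"] mod_hom_closed[OF l g] xc[OF j]
        by (simp add: mod_hom_smult[OF \<pi>h] c)
      moreover have "\<pi> (\<Oplus>\<^bsub>F\<^esub>i\<in>I'. ?r i \<odot>\<^bsub>F\<^esub> x' i) = \<zero>\<^bsub>R\<^esub>"
        using x'lin[OF r'] by (simp add: a_kernel_def')
      moreover have "\<pi> \<zero>\<^bsub>F\<^esub> = \<zero>\<^bsub>R\<^esub>"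
        using mod_hom_zero[OF F F.regular_module_module \<pi>h] by simp
      moreover have "l g \<otimes>\<^bsub>R\<^esub> c \<in> carrier R" using mod_hom_closed[OF l g] cc by simp
      ultimately show ?thesis by simp
    qed
    have "ann R c = l ` carrier G"
    proof
      show "l ` carrier G \<subseteq> ann R c" using annl mod_hom_closed[OF l] by (auto simp: ann_def)
      show "ann R c \<subseteq> l ` carrier G"
      proof
        fix t assume "t \<in> ann R c"
        then have t: "t \<in> carrier R" "t \<otimes>\<^bsub>R\<^esub> c = \<zero>\<^bsub>R\<^esub>" by (auto simp: ann_def)
        \<comment> \<open>\<open>c\<close> divides every coordinate of \<open>x j\<close>, so
          whatever kills \<open>c\<close> kills \<open>x j\<close>. The family with the single entry
          \<open>t\<close> at \<open>j\<close> is then a syzygy, and \<open>l\<close> takes the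
          value \<open>t\<close> there because \<open>s j\<close> is \<open>\<one>\<close>.\<close>
        have "t \<odot>\<^bsub>F\<^esub> x j = \<zero>\<^bsub>F\<^esub>"
        proof (rule \<Phi>(3))
          show "t \<odot>\<^bsub>F\<^esub> x j \<in> carrier F" using t xc j by simp
          fix \<rho> assume \<rho>: "\<rho> \<in> \<Phi>"
          obtain u where u: "u \<in> carrier R" "\<rho> (x j) = u \<otimes>\<^bsub>R\<^esub> c"
            using div[OF CI[OF \<rho> j]] by blast
          have "\<rho> (t \<odot>\<^bsub>F\<^esub> x j) = t \<otimes>\<^bsub>R\<^esub> (u \<otimes>\<^bsub>R\<^esub> c)"
            using mod_hom_smult[of \<rho> R F "regular_module R" t "x j"] \<Phi>(2) \<rho> t u xc[OF j] by auto
          also have "\<dots> = u \<otimes>\<^bsub>R\<^esub> (t \<otimes>\<^bsub>R\<^esub> c)" using t(1) u(1) cc by (simp add: F.R.m_lcomm)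
          finally show "\<rho> (t \<odot>\<^bsub>F\<^esub> x j) = \<zero>\<^bsub>R\<^esub>" using t u by simp
        qed
        let ?r = "\<lambda>i. if i = j then t else \<zero>\<^bsub>R\<^esub>"
        have r: "?r \<in> I \<rightarrow> carrier R" using t by auto
        have "(\<Oplus>\<^bsub>F\<^esub>i\<in>I. ?r i \<odot>\<^bsub>F\<^esub> x i) = \<zero>\<^bsub>F\<^esub>"
          using F.lincomb_single[OF I j x t(1)] \<open>t \<odot>\<^bsub>F\<^esub> x j = \<zero>\<^bsub>F\<^esub>\<close> by simp
        then obtain g where g: "g \<in> carrier G" "\<And>i. i \<in> I \<Longrightarrow> \<sigma> i g = ?r i"
          using syz[OF r] by metis
        have "l g = (\<Oplus>\<^bsub>regular_module R\<^esub>i\<in>I. ?r i \<odot>\<^bsub>regular_module R\<^esub> s i)"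
          unfolding l_reg
          by (rule reg.lincomb_cong) (use g r s in auto)
        also have "\<dots> = t \<odot>\<^bsub>regular_module R\<^esub> s j"
          by (rule reg.lincomb_single) (use I j s t in auto)
        finally show "t \<in> l ` carrier G" using g t s by (auto intro!: rev_image_eqI)
      qed
    qed
    then have "fg_ideal R (ann R c)"
      using fg_ideal_functional_image[OF G T l] by simp
    \<comment> \<open>Otherwise \<open>c\<close> would be a nonzero zero divisor with finitely
      generated annihilator.\<close>
    have cnz: "t = \<zero>\<^bsub>R\<^esub>" if "t \<in> carrier R" "t \<otimes>\<^bsub>R\<^esub> c = \<zero>\<^bsub>R\<^esub>" for t
    proof (rule ccontr)
      assume "t \<noteq> \<zero>\<^bsub>R\<^esub>"
      moreover have "c \<otimes>\<^bsub>R\<^esub> t = \<zero>\<^bsub>R\<^esub>" using that cc F.R.m_comm by metis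
      ultimately have "c \<in> zero_divisors R - {\<zero>\<^bsub>R\<^esub>}"
        using that(1) cc c0 unfolding zero_divisors_def by blast
      then show False using ann \<open>fg_ideal R (ann R c)\<close> by blast
    qed
    \<comment> \<open>The same \<open>G\<close> parametrises the syzygies of the \<open>x'\<close>.
      A relation among them extends to one among the \<open>x\<close> by choosing the entry at
      \<open>j\<close> so that the coefficient of \<open>x j\<close> cancels; conversely
      \<open>l g\<close> is zero because \<open>c\<close> is regular.\<close>
    have syz': "(\<Oplus>\<^bsub>F\<^esub>i\<in>I'. r i \<odot>\<^bsub>F\<^esub> x' i) = \<zero>\<^bsub>F\<^esub> \<longleftrightarrow> (\<exists>g \<in> carrier G. \<forall>i \<in> I'. r i = \<sigma> i g)"
      if r: "r \<in> I' \<rightarrow> carrier R" for r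
    proof
      assume 0: "(\<Oplus>\<^bsub>F\<^esub>i\<in>I'. r i \<odot>\<^bsub>F\<^esub> x' i) = \<zero>\<^bsub>F\<^esub>"
      let ?u = "\<Oplus>\<^bsub>R\<^esub>i\<in>I'. r i \<otimes>\<^bsub>R\<^esub> s i"
      let ?r = "r(j := \<ominus>\<^bsub>R\<^esub> ?u)"
      have rs: "(\<lambda>i. r i \<otimes>\<^bsub>R\<^esub> s i) \<in> I' \<rightarrow> carrier R" using r sc I' by (auto simp: Pi_iff)
      have u: "?u \<in> carrier R" by (rule F.R.finsum_closed[OF rs])
      have r': "?r \<in> I \<rightarrow> carrier R" using r u by (auto simp: I'(4))
      have "(\<Oplus>\<^bsub>R\<^esub>i\<in>I. ?r i \<otimes>\<^bsub>R\<^esub> s i) = ?r j \<otimes>\<^bsub>R\<^esub> s j \<oplus>\<^bsub>R\<^esub> (\<Oplus>\<^bsub>R\<^esub>i\<in>I'. ?r i \<otimes>\<^bsub>R\<^esub> s i)"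
        unfolding I'(4) by (rule F.R.finsum_insert) (use I' r' sc j in \<open>auto simp: Pi_iff\<close>)
      also have "(\<Oplus>\<^bsub>R\<^esub>i\<in>I'. ?r i \<otimes>\<^bsub>R\<^esub> s i) = ?u"
        by (rule F.R.finsum_cong') (use I' rs in \<open>auto simp: Pi_iff\<close>)
      finally have z: "(\<Oplus>\<^bsub>R\<^esub>i\<in>I. ?r i \<otimes>\<^bsub>R\<^esub> s i) = \<zero>\<^bsub>R\<^esub>" using u s(3) by (simp add: F.R.l_neg)
      have "(\<Oplus>\<^bsub>F\<^esub>i\<in>I'. ?r i \<odot>\<^bsub>F\<^esub> x' i) = (\<Oplus>\<^bsub>F\<^esub>i\<in>I'. r i \<odot>\<^bsub>F\<^esub> x' i)"
        by (rule F.lincomb_cong) (use I' r x'c in auto)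
      then have "(\<Oplus>\<^bsub>F\<^esub>i\<in>I. ?r i \<odot>\<^bsub>F\<^esub> x i) = \<zero>\<^bsub>F\<^esub>"
        unfolding decomp[OF r'] z 0[symmetric] using xc[OF j] x'lin_c[OF r] by simp
      then obtain g where "g \<in> carrier G" "\<forall>i \<in> I. ?r i = \<sigma> i g" using syz[OF r'] by blast
      then show "\<exists>g \<in> carrier G. \<forall>i \<in> I'. r i = \<sigma> i g" using I' by (metis fun_upd_other)
    next
      assume "\<exists>g \<in> carrier G. \<forall>i \<in> I'. r i = \<sigma> i g"
      then obtain g where g: "g \<in> carrier G" "\<And>i. i \<in> I' \<Longrightarrow> r i = \<sigma> i g" by blast
      let ?r = "\<lambda>i. \<sigma> i g"
      have r': "?r \<in> I \<rightarrow> carrier R" using \<sigma>c g by auto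
      have r'': "?r \<in> I' \<rightarrow> carrier R" using r' I' by auto
      have lg: "l g = \<zero>\<^bsub>R\<^esub>" using cnz annl[OF g(1)] mod_hom_closed[OF l g(1)] by simp
      have "(\<Oplus>\<^bsub>F\<^esub>i\<in>I'. r i \<odot>\<^bsub>F\<^esub> x' i) = (\<Oplus>\<^bsub>F\<^esub>i\<in>I'. ?r i \<odot>\<^bsub>F\<^esub> x' i)"
        by (rule F.lincomb_cong) (use g r'' x'c I' in auto)
      also have "\<dots> = (\<Oplus>\<^bsub>F\<^esub>i\<in>I. ?r i \<odot>\<^bsub>F\<^esub> x i)"
        using decomp[OF r'] lg xc[OF j] x'lin_c[OF r''] by (simp add: l_def)
      also have "\<dots> = \<zero>\<^bsub>F\<^esub>" using syz[OF r'] g by blast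
      finally show "(\<Oplus>\<^bsub>F\<^esub>i\<in>I'. r i \<odot>\<^bsub>F\<^esub> x' i) = \<zero>\<^bsub>F\<^esub>" .
    qed
    have "\<exists>B. finite B \<and> B \<subseteq> carrier F \<and> F.independent B \<and>
        (\<forall>H. submodule H R F \<longrightarrow> x' ` I' \<subseteq> H \<longleftrightarrow> B \<subseteq> H)"
      by (rule psubset.IH[OF I'(1) _ _ syz']) (use x'c \<sigma> I' in auto)
    then obtain B where B: "finite B" "B \<subseteq> carrier F" "F.independent B"
      and span: "\<And>H. submodule H R F \<Longrightarrow> x' ` I' \<subseteq> H \<longleftrightarrow> B \<subseteq> H" by blast
    have BK: "B \<subseteq> ?K" using span[OF K] x'K by blast
    have xjB: "x j \<notin> B" using BK c c0 by (auto simp: a_kernel_def')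
    \<comment> \<open>\<open>B\<close> lies in the kernel of \<open>\<pi>\<close>, so
      \<open>\<pi>\<close> isolates the coefficient of \<open>x j\<close>, which vanishes by
      regularity of \<open>c\<close>.\<close>
    have "F.independent (insert (x j) B)"
      unfolding F.independent_def
    proof (intro ballI impI)
      fix d b
      assume d: "d \<in> insert (x j) B \<rightarrow> carrier R"
        and 0: "(\<Oplus>\<^bsub>F\<^esub>b\<in>insert (x j) B. d b \<odot>\<^bsub>F\<^esub> b) = \<zero>\<^bsub>F\<^esub>" and b: "b \<in> insert (x j) B"
      let ?y = "\<Oplus>\<^bsub>F\<^esub>b\<in>B. d b \<odot>\<^bsub>F\<^esub> b"
      have dB: "d \<in> B \<rightarrow> carrier R" and dj: "d (x j) \<in> carrier R" using d by auto
      have y: "?y \<in> ?K" by (rule F.submodule_lincomb[OF K B(1) _ dB]) (use BK in auto)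
      then have yc: "?y \<in> carrier F" "\<pi> ?y = \<zero>\<^bsub>R\<^esub>" by (auto simp: a_kernel_def')
      have eq: "d (x j) \<odot>\<^bsub>F\<^esub> x j \<oplus>\<^bsub>F\<^esub> ?y = \<zero>\<^bsub>F\<^esub>"
        unfolding 0[symmetric]
        by (rule F.lincomb_insert[symmetric]) (use B xjB d xc[OF j] in auto)
      have "\<pi> (d (x j) \<odot>\<^bsub>F\<^esub> x j \<oplus>\<^bsub>F\<^esub> ?y) = d (x j) \<otimes>\<^bsub>R\<^esub> c \<oplus>\<^bsub>R\<^esub> \<zero>\<^bsub>R\<^esub>"
        using mod_hom_add[OF \<pi>h _ yc(1), of "d (x j) \<odot>\<^bsub>F\<^esub> x j"] yc dj xc[OF j]
        by (simp add: mod_hom_smult[OF \<pi>h] c)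
      then have "d (x j) \<otimes>\<^bsub>R\<^esub> c = \<zero>\<^bsub>R\<^esub>"
        using dj cc mod_hom_zero[OF F F.regular_module_module \<pi>h] by (simp add: eq)
      then have dj0: "d (x j) = \<zero>\<^bsub>R\<^esub>" using cnz dj by blast
      then have "?y = \<zero>\<^bsub>F\<^esub>" using eq xc[OF j] yc by simp
      then have "\<forall>b \<in> B. d b = \<zero>\<^bsub>R\<^esub>" using bspec[OF B(3)[unfolded F.independent_def] dB] by simp
      then show "d b = \<zero>\<^bsub>R\<^esub>" using b dj0 by auto
    qed
    \<comment> \<open>\<open>x i\<close> and \<open>x' i\<close> differ by a multiple of
      \<open>x j\<close>, so a submodule containing \<open>x j\<close> contains both or
      neither.\<close>
    moreover have "x ` I \<subseteq> H \<longleftrightarrow> insert (x j) B \<subseteq> H" if H: "submodule H R F" for H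
    proof -
      have "x i \<in> H \<longleftrightarrow> x' i \<in> H" if "x j \<in> H" "i \<in> I" for i
      proof
        have sH: "s i \<odot>\<^bsub>F\<^esub> x j \<in> H" using that sc F.submoduleE(4)[OF H] by blast
        show "x i \<in> H" if "x' i \<in> H"
          using xx'[OF \<open>i \<in> I\<close>] F.submoduleE(5)[OF H that sH] by simp
        show "x' i \<in> H" if "x i \<in> H"
          using F.submoduleE(5)[OF H that F.submoduleE(3)[OF H sH]] by (simp add: x'_def a_minus_def)
      qed
      then have "x ` I \<subseteq> H \<longleftrightarrow> x j \<in> H \<and> x' ` I' \<subseteq> H" using I' by (auto simp: image_subset_iff)
      then show ?thesis using span[OF H] by simp
    qed
    ultimately show ?thesis using B xc[OF j] by (intro exI[of _ "insert (x j) B"]) auto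
  qed
qed

section \<open>Quotients, free modules and projectivity\<close>

text \<open>The structure induced on the image of \<open>f\<close>, which has to be compatible with the module
  operations: a quotient module, or for injective \<open>f\<close> a copy in another carrier type. The
  multiplication and unit required by the record are dummies.\<close>

definition push_module :: "('m \<Rightarrow> 'n) \<Rightarrow> ('a, 'm) module \<Rightarrow> ('a, 'n) module" where
  "push_module f M = \<lparr>carrier = f ` carrier M, monoid.mult = (\<lambda>u v. u), one = f \<zero>\<^bsub>M\<^esub>,
     ring.zero = f \<zero>\<^bsub>M\<^esub>,
     add = (\<lambda>u v. f (inv_into (carrier M) f u \<oplus>\<^bsub>M\<^esub> inv_into (carrier M) f v)),
     smult = (\<lambda>a u. f (a \<odot>\<^bsub>M\<^esub> inv_into (carrier M) f u))\<rparr>"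

lemma push_module_simps [simp]:
  "carrier (push_module f M) = f ` carrier M"
  "\<zero>\<^bsub>push_module f M\<^esub> = f \<zero>\<^bsub>M\<^esub>"
  by (simp_all add: push_module_def)

text \<open>The operations on the image act on representatives picked by \<open>inv_into\<close>. By
  the two congruence hypotheses the result does not depend on that choice, so \<open>f\<close> is
  linear and the module laws carry over from \<open>M\<close>.\<close>

lemma push_module_hom:
  assumes M: "module R M"
    and add: "\<And>x x' y y'. \<lbrakk>x \<in> carrier M; x' \<in> carrier M; y \<in> carrier M; y' \<in> carrier M;
      f x = f x'; f y = f y'\<rbrakk> \<Longrightarrow> f (x \<oplus>\<^bsub>M\<^esub> y) = f (x' \<oplus>\<^bsub>M\<^esub> y')"
    and smult: "\<And>a x x'. \<lbrakk>a \<in> carrier R; x \<in> carrier M; x' \<in> carrier M; f x = f x'\<rbrakk>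
      \<Longrightarrow> f (a \<odot>\<^bsub>M\<^esub> x) = f (a \<odot>\<^bsub>M\<^esub> x')"
  shows "module R (push_module f M)" and "f \<in> mod_hom R M (push_module f M)"
proof -
  interpret module R M by fact
  have inv: "inv_into (carrier M) f (f x) \<in> carrier M"
    "f (inv_into (carrier M) f (f x)) = f x" if "x \<in> carrier M" for x
    using that by (auto intro: inv_into_into f_inv_into_f)
  have a: "f x \<oplus>\<^bsub>push_module f M\<^esub> f y = f (x \<oplus>\<^bsub>M\<^esub> y)"
    if "x \<in> carrier M" "y \<in> carrier M" for x y
    unfolding push_module_def using that inv by (auto intro: add)
  have s: "a \<odot>\<^bsub>push_module f M\<^esub> f x = f (a \<odot>\<^bsub>M\<^esub> x)"
    if "x \<in> carrier M" "a \<in> carrier R" for x a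
    unfolding push_module_def using that inv by (auto intro: smult)
  show "f \<in> mod_hom R M (push_module f M)"
    by (rule mod_homI) (auto simp: a s)
  show "module R (push_module f M)"
  proof (rule moduleI)
    show "cring R" ..
    show "abelian_group (push_module f M)"
    proof (rule abelian_groupI)
      fix u assume "u \<in> carrier (push_module f M)"
      then obtain x where x: "x \<in> carrier M" "u = f x" by auto
      have "f (\<ominus>\<^bsub>M\<^esub> x) \<oplus>\<^bsub>push_module f M\<^esub> u = \<zero>\<^bsub>push_module f M\<^esub>"
        using x by (simp add: a M.l_neg)
      then show "\<exists>v \<in> carrier (push_module f M). v \<oplus>\<^bsub>push_module f M\<^esub> u = \<zero>\<^bsub>push_module f M\<^esub>"
        using x by (intro bexI[of _ "f (\<ominus>\<^bsub>M\<^esub> x)"]) auto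
    qed (auto simp: a M.a_assoc M.a_comm M.a_lcomm)
  qed (auto simp: a s smult_l_distr smult_r_distr smult_assoc1)
qed

lemma push_module_inj:
  assumes M: "module R M" and f: "inj_on f (carrier M)"
  shows "module R (push_module f M)" and "f \<in> mod_hom R M (push_module f M)"
proof -
  have "x = x'" if "x \<in> carrier M" "x' \<in> carrier M" "f x = f x'" for x x'
    using f that by (simp add: inj_on_def)
  then show "module R (push_module f M)" and "f \<in> mod_hom R M (push_module f M)"
    by (intro push_module_hom[OF M]; metis)+
qed

text \<open>Allowing any left inverse \<open>g\<close> lets concrete functions such as
  \<open>hd\<close> serve as inverses of the embeddings into lists.\<close>

lemma mod_hom_inverse:
  assumes M: "module R M" and f: "f \<in> mod_hom R M N" and g: "\<And>x. x \<in> carrier M \<Longrightarrow> g (f x) = x"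
    and surj: "f ` carrier M = carrier N"
  shows "g \<in> mod_hom R N M"
proof -
  interpret module R M by fact
  show ?thesis
  proof (rule mod_homI)
    fix u assume "u \<in> carrier N"
    then obtain x where x: "x \<in> carrier M" "u = f x" using surj by blast
    show "g u \<in> carrier M" using x g by simp
    show "g (a \<odot>\<^bsub>N\<^esub> u) = a \<odot>\<^bsub>M\<^esub> g u" if "a \<in> carrier R" for a
      using g[of "a \<odot>\<^bsub>M\<^esub> x"] x that by (simp add: mod_hom_smult[OF f] g)
    fix v assume "v \<in> carrier N"
    then obtain y where y: "y \<in> carrier M" "v = f y" using surj by blast
    show "g (u \<oplus>\<^bsub>N\<^esub> v) = g u \<oplus>\<^bsub>M\<^esub> g v"
      using g[of "x \<oplus>\<^bsub>M\<^esub> y"] x y by (simp add: mod_hom_add[OF f] g)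
  qed
qed

text \<open>The definition of projectivity is tied to the carrier type, so it is established
  directly for the copy: a lifting problem is pulled back along \<open>f\<close>, solved on a basis
  of \<open>P\<close>, and transported by the inverse of \<open>f\<close>.\<close>

lemma finite_free_push_projective:
  fixes P :: "('a, 'p) module" and f :: "'p \<Rightarrow> 'q"
  assumes "finite_free_module R P" and f: "inj_on f (carrier P)"
  shows "projective_module R (push_module f P)"
  unfolding projective_module_def
proof (intro conjI allI impI)
  have P: "module R P" using assms(1) by (simp add: finite_free_module_def)
  note push = push_module_inj[OF P f]
  show "module R (push_module f P)" by (rule push)
  let ?g = "inv_into (carrier P) f"
  have g: "?g \<in> mod_hom R (push_module f P) P"
    by (rule mod_hom_inverse[OF P push(2)]) (use f in auto)
  fix M :: "('a, 'q \<Rightarrow> 'a) module" and N :: "('a, 'q) module" and e k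
  assume *: "module R M \<and> module R N \<and> e \<in> mod_hom R M N \<and> e ` carrier M = carrier N \<and>
    k \<in> mod_hom R (push_module f P) N"
  then have "(\<lambda>x. k (f x)) \<in> mod_hom R P N" using mod_hom_comp[OF push(2)] by blast
  with * obtain h where h: "h \<in> mod_hom R P M" "\<And>x. x \<in> carrier P \<Longrightarrow> e (h x) = k (f x)"
    using finite_basis_lifting[OF assms(1), of M N e "\<lambda>x. k (f x)"] by blast
  show "\<exists>h \<in> mod_hom R (push_module f P) M. \<forall>x \<in> carrier (push_module f P). e (h x) = k x"
    by (rule bexI[OF _ mod_hom_comp[OF g h(1)]]) (use f h in auto)
qed

text \<open>Functions on the whole type, forced to vanish off \<open>S\<close>. For
  \<open>S = carrier P\<close> this has exactly the carrier type that
  \<open>projective_module\<close> allows for the source of an epimorphism onto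
  \<open>P\<close>.\<close>

definition free_module :: "('a, 'r) ring_scheme \<Rightarrow> 'p set \<Rightarrow> ('a, 'p \<Rightarrow> 'a) module" where
  "free_module R S =
     \<lparr>carrier = {c. (\<forall>p. c p \<in> carrier R) \<and> finite {p. c p \<noteq> \<zero>\<^bsub>R\<^esub>} \<and> (\<forall>p. p \<notin> S \<longrightarrow> c p = \<zero>\<^bsub>R\<^esub>)},
      monoid.mult = (\<lambda>c d. c), one = (\<lambda>p. \<zero>\<^bsub>R\<^esub>), ring.zero = (\<lambda>p. \<zero>\<^bsub>R\<^esub>),
      add = (\<lambda>c d p. c p \<oplus>\<^bsub>R\<^esub> d p), smult = (\<lambda>a c p. a \<otimes>\<^bsub>R\<^esub> c p)\<rparr>"

lemma free_module_simps [simp]: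
  "c \<in> carrier (free_module R S) \<longleftrightarrow>
     (\<forall>p. c p \<in> carrier R) \<and> finite {p. c p \<noteq> \<zero>\<^bsub>R\<^esub>} \<and> (\<forall>p. p \<notin> S \<longrightarrow> c p = \<zero>\<^bsub>R\<^esub>)"
  "\<zero>\<^bsub>free_module R S\<^esub> = (\<lambda>p. \<zero>\<^bsub>R\<^esub>)"
  "c \<oplus>\<^bsub>free_module R S\<^esub> d = (\<lambda>p. c p \<oplus>\<^bsub>R\<^esub> d p)"
  "a \<odot>\<^bsub>free_module R S\<^esub> c = (\<lambda>p. a \<otimes>\<^bsub>R\<^esub> c p)"
  by (simp_all add: free_module_def)

lemma (in cring) free_module_module: "module R (free_module R S)"
proof -
  have add: "finite {p. c p \<oplus> d p \<noteq> \<zero>}" if "finite {p. c p \<noteq> \<zero>}" "finite {p. d p \<noteq> \<zero>}" for c d :: "'p \<Rightarrow> 'a"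
    by (rule finite_subset[of _ "{p. c p \<noteq> \<zero>} \<union> {p. d p \<noteq> \<zero>}"]) (use that in auto)
  have smult: "finite {p. a \<otimes> c p \<noteq> \<zero>}" if "finite {p. c p \<noteq> \<zero>}" "a \<in> carrier R" for c :: "'p \<Rightarrow> 'a" and a
    by (rule finite_subset[of _ "{p. c p \<noteq> \<zero>}"]) (use that in auto)
  show ?thesis
  proof (rule moduleI)
    show "cring R" ..
    show "abelian_group (free_module R S)"
    proof (rule abelian_groupI)
      fix c assume c: "c \<in> carrier (free_module R S)"
      have "{p. \<ominus> (c p) \<noteq> \<zero>} = {p. c p \<noteq> \<zero>}"
        using c by (metis free_module_simps(1) minus_minus minus_zero)
      then show "\<exists>d \<in> carrier (free_module R S). d \<oplus>\<^bsub>free_module R S\<^esub> c = \<zero>\<^bsub>free_module R S\<^esub>"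
        using c by (intro bexI[of _ "\<lambda>p. \<ominus> (c p)"]) (auto simp: l_neg)
    qed (auto simp: add fun_eq_iff a_assoc a_comm a_lcomm)
  qed (auto simp: smult fun_eq_iff l_distr r_distr m_assoc)
qed

text \<open>Evaluating formal combinations gives every module, finitely generated or not, a free
  cover; the identity of a projective module can be lifted against it.\<close>

lemma free_module_eval:
  fixes M :: "('a, 'm) module"
  assumes M: "module R M"
  obtains g where "g \<in> mod_hom R (free_module R (carrier M)) M"
    "g ` carrier (free_module R (carrier M)) = carrier M"
proof -
  interpret module R M by fact
  let ?L = "free_module R (carrier M)"
  let ?supp = "\<lambda>c. {p. c p \<noteq> \<zero>\<^bsub>R\<^esub>}"
  define g where "g c = (\<Oplus>\<^bsub>M\<^esub>p\<in>?supp c. c p \<odot>\<^bsub>M\<^esub> p)" for c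
  have supp: "?supp c \<subseteq> carrier M" if "c \<in> carrier ?L" for c
    using that by auto
  \<comment> \<open>Supports vary with \<open>c\<close> and may shrink under addition, so sums are
    moved to a common finite set before they are compared.\<close>
  have geq: "g c = (\<Oplus>\<^bsub>M\<^esub>p\<in>A. c p \<odot>\<^bsub>M\<^esub> p)"
    if "c \<in> carrier ?L" "finite A" "A \<subseteq> carrier M" "?supp c \<subseteq> A" for A c
    unfolding g_def
    by (rule M.add.finprod_mono_neutral_cong_left) (use that in \<open>auto simp: subset_iff\<close>)
  have hom: "g \<in> mod_hom R ?L M"
  proof (rule mod_homI)
    show "g c \<in> carrier M" if "c \<in> carrier ?L" for c
      unfolding g_def by (rule lincomb_closed) (use that supp[OF that] in auto)
    show "g (c \<oplus>\<^bsub>?L\<^esub> d) = g c \<oplus>\<^bsub>M\<^esub> g d" if c: "c \<in> carrier ?L" and d: "d \<in> carrier ?L" for c d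
    proof -
      let ?A = "?supp c \<union> ?supp d"
      have A: "finite ?A" "?A \<subseteq> carrier M" using c d supp[OF c] supp[OF d] by auto
      have cd: "c \<oplus>\<^bsub>?L\<^esub> d \<in> carrier ?L"
        using module.axioms(2)[OF free_module_module[of "carrier M"]] c d
        by (meson abelian_groupE(1))
      have "g (c \<oplus>\<^bsub>?L\<^esub> d) = (\<Oplus>\<^bsub>M\<^esub>p\<in>?A. (c p \<oplus>\<^bsub>R\<^esub> d p) \<odot>\<^bsub>M\<^esub> p)"
        by (subst geq[OF cd A]) auto
      also have "\<dots> = (\<Oplus>\<^bsub>M\<^esub>p\<in>?A. c p \<odot>\<^bsub>M\<^esub> p) \<oplus>\<^bsub>M\<^esub> (\<Oplus>\<^bsub>M\<^esub>p\<in>?A. d p \<odot>\<^bsub>M\<^esub> p)"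
        by (rule lincomb_add) (use c d A in auto)
      also have "\<dots> = g c \<oplus>\<^bsub>M\<^esub> g d"
        using geq[OF c A] geq[OF d A] by simp
      finally show ?thesis .
    qed
    show "g (a \<odot>\<^bsub>?L\<^esub> c) = a \<odot>\<^bsub>M\<^esub> g c" if a: "a \<in> carrier R" and c: "c \<in> carrier ?L" for a c
    proof -
      let ?A = "?supp c"
      have A: "finite ?A" "?A \<subseteq> carrier M" using c supp[OF c] by auto
      have ac: "a \<odot>\<^bsub>?L\<^esub> c \<in> carrier ?L"
        using module.smult_closed[OF free_module_module a c] .
      have "g (a \<odot>\<^bsub>?L\<^esub> c) = (\<Oplus>\<^bsub>M\<^esub>p\<in>?A. (a \<otimes>\<^bsub>R\<^esub> c p) \<odot>\<^bsub>M\<^esub> p)"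
        by (subst geq[OF ac A]) (use a in auto)
      also have "\<dots> = a \<odot>\<^bsub>M\<^esub> g c"
        unfolding g_def by (rule lincomb_smult) (use a c A in auto)
      finally show ?thesis .
    qed
  qed
  moreover have "g ` carrier ?L = carrier M"
  proof
    show "g ` carrier ?L \<subseteq> carrier M" using mod_hom_closed[OF hom] by blast
    show "carrier M \<subseteq> g ` carrier ?L"
    proof
      fix x assume x: "x \<in> carrier M"
      let ?c = "\<lambda>p. if p = x then \<one>\<^bsub>R\<^esub> else \<zero>\<^bsub>R\<^esub>"
      have c: "?c \<in> carrier ?L" using x by (auto intro: finite_subset[of _ "{x}"])
      have "g ?c = (\<Oplus>\<^bsub>M\<^esub>p\<in>{x}. ?c p \<odot>\<^bsub>M\<^esub> p)"
        by (rule geq[OF c]) (use x in auto)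
      also have "\<dots> = \<one>\<^bsub>R\<^esub> \<odot>\<^bsub>M\<^esub> x"
        by (rule lincomb_single) (use x in auto)
      finally show "x \<in> g ` carrier ?L" using c x by (metis imageI smult_one)
    qed
  qed
  ultimately show thesis using that by blast
qed

section \<open>Finite projective dimension and annihilators\<close>

text \<open>For \<open>a \<otimes> b = \<zero>\<close> and a submodule \<open>C\<close> this is
  exactness of multiplication by \<open>b\<close> followed by multiplication by \<open>a\<close> on
  \<open>C\<close>. The set \<open>C\<close> is separate from \<open>M\<close> so that kernels need
  not be made into modules.\<close>

definition annihilator_exact :: "('a, 'm) module \<Rightarrow> 'a \<Rightarrow> 'a \<Rightarrow> 'm set \<Rightarrow> bool" where
  "annihilator_exact M a b C \<longleftrightarrow>
     (\<forall>x \<in> C. a \<odot>\<^bsub>M\<^esub> x = \<zero>\<^bsub>M\<^esub> \<longrightarrow> (\<exists>y \<in> C. x = b \<odot>\<^bsub>M\<^esub> y))"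

text \<open>The identity lifts to the free cover, so \<open>P\<close> is a direct summand of a free
  module, which inherits the property coordinatewise from the ring.\<close>

lemma projective_annihilator_exact:
  fixes P :: "('a, 'p) module"
  assumes P: "projective_module R P" and ab: "a \<in> carrier R" "b \<in> carrier R"
    and R: "annihilator_exact (regular_module R) a b (carrier R)"
  shows "annihilator_exact P a b (carrier P)"
proof -
  have mP: "module R P" using P by (simp add: projective_module_def)
  interpret P: module R P by fact
  let ?L = "free_module R (carrier P)"
  have L: "module R ?L" by (rule P.free_module_module)
  obtain g where g: "g \<in> mod_hom R ?L P" "g ` carrier ?L = carrier P"
    by (rule free_module_eval[OF mP])
  have "(\<lambda>x. x) \<in> mod_hom R P P" by (auto intro: mod_homI)
  then have "\<exists>h \<in> mod_hom R P ?L. \<forall>x \<in> carrier P. g (h x) = x"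
    using P L mP g unfolding projective_module_def by blast
  then obtain h where h: "h \<in> mod_hom R P ?L" "\<And>x. x \<in> carrier P \<Longrightarrow> g (h x) = x" by blast
  show ?thesis
    unfolding annihilator_exact_def
  proof (intro ballI impI)
    fix x assume x: "x \<in> carrier P" and ax: "a \<odot>\<^bsub>P\<^esub> x = \<zero>\<^bsub>P\<^esub>"
    have hx: "h x \<in> carrier ?L" by (rule mod_hom_closed[OF h(1) x])
    have "a \<odot>\<^bsub>?L\<^esub> h x = \<zero>\<^bsub>?L\<^esub>"
      using mod_hom_smult[OF h(1) ab(1) x] mod_hom_zero[OF mP L h(1)] ax by simp
    then have "a \<otimes>\<^bsub>R\<^esub> h x p = \<zero>\<^bsub>R\<^esub>" for p by (simp add: fun_eq_iff)
    then have "\<exists>y \<in> carrier R. h x p = b \<otimes>\<^bsub>R\<^esub> y" for p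
      using R hx by (simp add: annihilator_exact_def)
    \<comment> \<open>Zero coordinates receive the quotient zero, so that the chosen family
      \<open>d\<close> has finite support.\<close>
    then have "\<exists>y \<in> carrier R. h x p = b \<otimes>\<^bsub>R\<^esub> y \<and> (h x p = \<zero>\<^bsub>R\<^esub> \<longrightarrow> y = \<zero>\<^bsub>R\<^esub>)" for p
      using ab(2) by (cases "h x p = \<zero>\<^bsub>R\<^esub>") auto
    then obtain d where d: "\<And>p. d p \<in> carrier R" "\<And>p. h x p = b \<otimes>\<^bsub>R\<^esub> d p"
        "\<And>p. h x p = \<zero>\<^bsub>R\<^esub> \<Longrightarrow> d p = \<zero>\<^bsub>R\<^esub>"
      by metis
    have "finite {p. d p \<noteq> \<zero>\<^bsub>R\<^esub>}"
      by (rule finite_subset[of _ "{p. h x p \<noteq> \<zero>\<^bsub>R\<^esub>}"]) (use d(3) hx in auto)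
    then have dL: "d \<in> carrier ?L" using d hx by simp
    have "h x = b \<odot>\<^bsub>?L\<^esub> d" using d(2) by (simp add: fun_eq_iff)
    then have "x = b \<odot>\<^bsub>P\<^esub> g d"
      using h(2)[OF x] mod_hom_smult[OF g(1) ab(2) dL] by simp
    then show "\<exists>y \<in> carrier P. x = b \<odot>\<^bsub>P\<^esub> y" using mod_hom_closed[OF g(1) dL] by blast
  qed
qed

text \<open>Multiplication by \<open>a\<close> and \<open>b\<close> turns a module into a \<open>2\<close>-periodic complex, and this is
  the part of the long exact homology sequence of \<open>0 \<rightarrow> ker h \<rightarrow> M \<rightarrow> h M \<rightarrow> 0\<close> that is needed.\<close>

lemma annihilator_exact_image:
  assumes M: "module R M" and N: "module R N" and h: "h \<in> mod_hom R M N"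
    and ab: "a \<in> carrier R" "b \<in> carrier R" "b \<otimes>\<^bsub>R\<^esub> a = \<zero>\<^bsub>R\<^esub>"
    and exM: "annihilator_exact M a b (carrier M)"
    and exK: "annihilator_exact M b a (a_kernel M N h)"
  shows "annihilator_exact N a b (h ` carrier M)"
  unfolding annihilator_exact_def
proof (intro ballI impI)
  interpret M: module R M by fact
  interpret N: module R N by fact
  fix x assume "x \<in> h ` carrier M" and ax: "a \<odot>\<^bsub>N\<^esub> x = \<zero>\<^bsub>N\<^esub>"
  then obtain p where p: "p \<in> carrier M" "x = h p" by blast
  \<comment> \<open>The element \<open>a p\<close> lies in the kernel and is killed by
    \<open>b\<close>, so it equals \<open>a k\<close> for some \<open>k\<close> in the kernel. Then
    \<open>p - k\<close> still maps to \<open>x\<close>, but is killed by \<open>a\<close> already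
    in \<open>M\<close>.\<close>
  have "a \<odot>\<^bsub>M\<^esub> p \<in> a_kernel M N h"
    using p ax ab by (simp add: a_kernel_def' mod_hom_smult[OF h])
  moreover have "b \<odot>\<^bsub>M\<^esub> (a \<odot>\<^bsub>M\<^esub> p) = \<zero>\<^bsub>M\<^esub>"
    using p ab by (simp add: M.smult_assoc1[symmetric])
  ultimately obtain k where k: "k \<in> carrier M" "h k = \<zero>\<^bsub>N\<^esub>" "a \<odot>\<^bsub>M\<^esub> p = a \<odot>\<^bsub>M\<^esub> k"
    using exK unfolding annihilator_exact_def a_kernel_def' by blast
  have "a \<odot>\<^bsub>M\<^esub> (p \<ominus>\<^bsub>M\<^esub> k) = \<zero>\<^bsub>M\<^esub>"
    using p k ab by (simp add: a_minus_def M.smult_r_distr M.smult_r_minus M.M.r_neg)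
  then obtain y where y: "y \<in> carrier M" "p \<ominus>\<^bsub>M\<^esub> k = b \<odot>\<^bsub>M\<^esub> y"
    using exM p k unfolding annihilator_exact_def by (meson M.M.minus_closed)
  have "x = h (p \<ominus>\<^bsub>M\<^esub> k)"
    using mod_hom_minus[OF M N h p(1) k(1)] mod_hom_closed[OF h p(1)] p k
    by (simp add: a_minus_def[of N])
  also have "\<dots> = h (b \<odot>\<^bsub>M\<^esub> y)" by (simp only: y)
  also have "\<dots> = b \<odot>\<^bsub>N\<^esub> h y" using y ab by (simp add: mod_hom_smult[OF h])
  finally show "\<exists>y \<in> h ` carrier M. x = b \<odot>\<^bsub>N\<^esub> y" using y by blast
qed

text \<open>Descending induction on the kernels, from the zero kernel at \<open>d\<close>: below it,
  each kernel is the image of the next higher term. As \<open>annihilator_exact_image\<close>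
  exchanges \<open>a\<close> and \<open>b\<close>, both orders are carried along.\<close>

lemma annihilator_exact_of_resolution:
  assumes ex: "aug_exact R E P \<epsilon> \<delta> d"
    and proj: "\<And>i. i \<le> d \<Longrightarrow> projective_module R (P i)"
    and top: "diff_kernel E P \<epsilon> \<delta> d = {\<zero>\<^bsub>P d\<^esub>}"
    and ab: "a \<in> carrier R" "b \<in> carrier R" "a \<otimes>\<^bsub>R\<^esub> b = \<zero>\<^bsub>R\<^esub>" "b \<otimes>\<^bsub>R\<^esub> a = \<zero>\<^bsub>R\<^esub>"
    and Rab: "annihilator_exact (regular_module R) a b (carrier R)"
    and Rba: "annihilator_exact (regular_module R) b a (carrier R)"
  shows "annihilator_exact E a b (carrier E)"
proof -
  have P: "module R (P i)" if "i \<le> d" for i using ex that by (simp add: aug_exact_def)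
  have Pex: "annihilator_exact (P i) a b (carrier (P i))" "annihilator_exact (P i) b a (carrier (P i))"
    if "i \<le> d" for i
    using projective_annihilator_exact[OF proj[OF that]] ab Rab Rba by auto
  have "annihilator_exact (P i) a b (diff_kernel E P \<epsilon> \<delta> i) \<and>
      annihilator_exact (P i) b a (diff_kernel E P \<epsilon> \<delta> i)" if "i \<le> d" for i
    using that
  proof (induction i rule: inc_induct)
    case base
    interpret module R "P d" by (rule P) simp
    show ?case using ab by (simp add: top annihilator_exact_def)
  next
    case (step i)
    have \<delta>: "\<delta> i \<in> mod_hom R (P (Suc i)) (P i)"
      and im: "diff_kernel E P \<epsilon> \<delta> i = \<delta> i ` carrier (P (Suc i))"
      using ex step.hyps by (auto simp: aug_exact_def)
    have "diff_kernel E P \<epsilon> \<delta> (Suc i) = a_kernel (P (Suc i)) (P i) (\<delta> i)"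
      by (simp add: diff_kernel_def)
    then show ?case
      using annihilator_exact_image[OF P P \<delta>] Pex[of "Suc i"] step ab unfolding im by auto
  qed
  from this[of 0] have K: "annihilator_exact (P 0) b a (a_kernel (P 0) E \<epsilon>)"
    by (simp add: diff_kernel_def)
  have "module R E" "\<epsilon> \<in> mod_hom R (P 0) E" "\<epsilon> ` carrier (P 0) = carrier E"
    using ex by (auto simp: aug_exact_def)
  then show ?thesis
    using annihilator_exact_image[OF P[of 0] _ _ ab(1,2,4) Pex(1)[of 0] K] by auto
qed

section \<open>Exact pairs and the quotient by a principal ideal\<close>

lemma proj_dim_leD:
  assumes "proj_dim R E \<le> enat d"
  shows "\<exists>k. has_projective_resolution R E k"
proof (rule ccontr)
  assume "\<not> ?thesis"
  then have "proj_dim R E = \<infinity>" by (simp add: proj_dim_def top_enat_def)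
  then show False using assms by simp
qed

text \<open>Used with \<open>f\<close> forming one-element lists, which puts a free module of rank 1
  into the carrier type that \<open>n_presented\<close> prescribes.\<close>

lemma (in cring) regular_push_finite_free:
  assumes "inj_on f (carrier R)"
  shows "finite_free_module R (push_module f (regular_module R))"
proof -
  let ?L = "push_module f (regular_module R)"
  have inj: "inj_on f (carrier (regular_module R))" using assms by simp
  have L: "module R ?L" and f: "f \<in> mod_hom R (regular_module R) ?L"
    using push_module_inj[OF regular_module_module inj] by auto
  interpret L: module R ?L by (rule L)
  have smult: "r \<odot>\<^bsub>?L\<^esub> f \<one> = f r" if "r \<in> carrier R" for r
    using mod_hom_smult[OF f that, of \<one>] that by simp
  have sum: "(\<Oplus>\<^bsub>?L\<^esub>b\<in>{f \<one>}. c b \<odot>\<^bsub>?L\<^esub> b) = f (c (f \<one>))" if "c (f \<one>) \<in> carrier R" for c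
  proof -
    have "f (c (f \<one>)) \<in> carrier ?L" using that by simp
    then show ?thesis using that by (simp add: smult)
  qed
  have "module_basis R ?L {f \<one>}"
    unfolding module_basis_finite_iff[OF L finite.insertI[OF finite.emptyI]]
  proof (intro conjI ballI)
    show "{f \<one>} \<subseteq> carrier ?L" by simp
    show "L.independent {f \<one>}"
      unfolding L.independent_def using assms by (auto simp: sum inj_on_def)
    fix x assume "x \<in> carrier ?L"
    then obtain r where "r \<in> carrier R" "x = f r" by auto
    then show "\<exists>c \<in> {f \<one>} \<rightarrow> carrier R. x = (\<Oplus>\<^bsub>?L\<^esub>b\<in>{f \<one>}. c b \<odot>\<^bsub>?L\<^esub> b)"
      by (intro bexI[of _ "\<lambda>_. r"]) (auto simp: sum)
  qed
  then show ?thesis using L unfolding finite_free_module_def by blast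
qed

text \<open>In the quotient by \<open>a\<close> the class of 1 is killed by \<open>a\<close>; a
  projective resolution of any length would make it \<open>b\<close> times another class, which
  \<open>proper\<close> excludes. The quotient is 2-presented because the kernel of multiplication
  by \<open>a\<close> is again principal, generated by \<open>b\<close>.\<close>

lemma not_nd_ring_if_exact_pair:
  fixes R :: "('a, 'r) ring_scheme"
  assumes R: "cring R" and ab: "a \<in> carrier R" "b \<in> carrier R"
    and anna: "ann R a = PIdl\<^bsub>R\<^esub> b" and annb: "ann R b = PIdl\<^bsub>R\<^esub> a"
    and proper: "\<And>s t. \<lbrakk>s \<in> carrier R; t \<in> carrier R\<rbrakk> \<Longrightarrow> \<one>\<^bsub>R\<^esub> \<noteq> b \<otimes>\<^bsub>R\<^esub> s \<oplus>\<^bsub>R\<^esub> t \<otimes>\<^bsub>R\<^esub> a"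
  shows "\<not> nd_ring R 2 d"
proof
  assume nd: "nd_ring R 2 d"
  interpret cring R by fact
  have ann: "x \<otimes>\<^bsub>R\<^esub> a = \<zero>\<^bsub>R\<^esub> \<longleftrightarrow> (\<exists>y \<in> carrier R. x = y \<otimes>\<^bsub>R\<^esub> b)"
    "x \<otimes>\<^bsub>R\<^esub> b = \<zero>\<^bsub>R\<^esub> \<longleftrightarrow> (\<exists>y \<in> carrier R. x = y \<otimes>\<^bsub>R\<^esub> a)" if "x \<in> carrier R" for x
    using anna annb that by (auto simp: ann_def cgenideal_def)
  have ab0: "a \<otimes>\<^bsub>R\<^esub> b = \<zero>\<^bsub>R\<^esub>" "b \<otimes>\<^bsub>R\<^esub> a = \<zero>\<^bsub>R\<^esub>"
    using ann(1)[of b] ab m_comm by (auto intro!: bexI[of _ "\<one>\<^bsub>R\<^esub>"])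
  have ex: "annihilator_exact (regular_module R) a b (carrier R)"
    "annihilator_exact (regular_module R) b a (carrier R)"
    using ann ab by (auto simp: annihilator_exact_def m_comm)
  \<comment> \<open>Cosets of the ideal generated by \<open>a\<close>, written as sets of
    one-element lists because \<open>nd_ring\<close> fixes the carrier type
    \<open>'a list set\<close>.\<close>
  define cls where "cls x = (\<lambda>t. [x \<oplus>\<^bsub>R\<^esub> t \<otimes>\<^bsub>R\<^esub> a]) ` carrier R" for x
  have cls_iff: "cls x = cls x' \<longleftrightarrow> (\<exists>t \<in> carrier R. x' = x \<oplus>\<^bsub>R\<^esub> t \<otimes>\<^bsub>R\<^esub> a)"
    if x: "x \<in> carrier R" "x' \<in> carrier R" for x x'
  proof
    assume eq: "cls x = cls x'"
    have "[x'] \<in> cls x'" using x ab by (auto simp: cls_def intro!: image_eqI[of _ _ "\<zero>\<^bsub>R\<^esub>"])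
    then show "\<exists>t \<in> carrier R. x' = x \<oplus>\<^bsub>R\<^esub> t \<otimes>\<^bsub>R\<^esub> a" unfolding eq[symmetric] by (auto simp: cls_def)
  next
    assume "\<exists>t \<in> carrier R. x' = x \<oplus>\<^bsub>R\<^esub> t \<otimes>\<^bsub>R\<^esub> a"
    then obtain t where t: "t \<in> carrier R" "x' = x \<oplus>\<^bsub>R\<^esub> t \<otimes>\<^bsub>R\<^esub> a" by blast
    have "[x' \<oplus>\<^bsub>R\<^esub> u \<otimes>\<^bsub>R\<^esub> a] \<in> cls x" if u: "u \<in> carrier R" for u
    proof -
      have "x' \<oplus>\<^bsub>R\<^esub> u \<otimes>\<^bsub>R\<^esub> a = x \<oplus>\<^bsub>R\<^esub> (t \<oplus>\<^bsub>R\<^esub> u) \<otimes>\<^bsub>R\<^esub> a"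
        unfolding t(2) using u t(1) x ab by algebra
      then show ?thesis using u t(1) by (simp add: cls_def)
    qed
    moreover have "[x \<oplus>\<^bsub>R\<^esub> u \<otimes>\<^bsub>R\<^esub> a] \<in> cls x'" if u: "u \<in> carrier R" for u
    proof -
      have "x \<oplus>\<^bsub>R\<^esub> u \<otimes>\<^bsub>R\<^esub> a = x' \<oplus>\<^bsub>R\<^esub> (u \<ominus>\<^bsub>R\<^esub> t) \<otimes>\<^bsub>R\<^esub> a"
        unfolding t(2) using u t(1) x ab by algebra
      then show ?thesis using u t(1) by (simp add: cls_def)
    qed
    ultimately show "cls x = cls x'" unfolding cls_def by blast
  qed
  let ?E = "push_module cls (regular_module R)"
  have cls_add: "cls (x \<oplus>\<^bsub>R\<^esub> y) = cls (x' \<oplus>\<^bsub>R\<^esub> y')"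
    if c: "x \<in> carrier R" "x' \<in> carrier R" "y \<in> carrier R" "y' \<in> carrier R"
      and eq: "cls x = cls x'" "cls y = cls y'" for x x' y y'
  proof -
    obtain t where t: "t \<in> carrier R" "x' = x \<oplus>\<^bsub>R\<^esub> t \<otimes>\<^bsub>R\<^esub> a"
      using eq(1) c by (auto simp: cls_iff)
    obtain u where u: "u \<in> carrier R" "y' = y \<oplus>\<^bsub>R\<^esub> u \<otimes>\<^bsub>R\<^esub> a"
      using eq(2) c by (auto simp: cls_iff)
    have "x' \<oplus>\<^bsub>R\<^esub> y' = x \<oplus>\<^bsub>R\<^esub> y \<oplus>\<^bsub>R\<^esub> (t \<oplus>\<^bsub>R\<^esub> u) \<otimes>\<^bsub>R\<^esub> a"
      unfolding t(2) u(2) using t(1) u(1) c ab by algebra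
    then show ?thesis
      using t(1) u(1) c ab by (subst cls_iff) auto
  qed
  have cls_smult: "cls (r \<otimes>\<^bsub>R\<^esub> x) = cls (r \<otimes>\<^bsub>R\<^esub> x')"
    if c: "r \<in> carrier R" "x \<in> carrier R" "x' \<in> carrier R" and eq: "cls x = cls x'" for r x x'
  proof -
    obtain t where t: "t \<in> carrier R" "x' = x \<oplus>\<^bsub>R\<^esub> t \<otimes>\<^bsub>R\<^esub> a"
      using eq c by (auto simp: cls_iff)
    have "r \<otimes>\<^bsub>R\<^esub> x' = r \<otimes>\<^bsub>R\<^esub> x \<oplus>\<^bsub>R\<^esub> (r \<otimes>\<^bsub>R\<^esub> t) \<otimes>\<^bsub>R\<^esub> a"
      unfolding t(2) using t(1) c ab by algebra
    then show ?thesis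
      using t(1) c ab by (subst cls_iff) auto
  qed
  have E: "module R ?E" and cls: "cls \<in> mod_hom R (regular_module R) ?E"
    by (rule push_module_hom[OF regular_module_module]; unfold regular_module_simps;
      rule cls_add cls_smult; assumption)+
  interpret E: module R ?E by (rule E)
  have cls0: "cls x = cls \<zero>\<^bsub>R\<^esub> \<longleftrightarrow> (\<exists>t \<in> carrier R. x = t \<otimes>\<^bsub>R\<^esub> a)" if "x \<in> carrier R" for x
  proof -
    have "cls x = cls \<zero>\<^bsub>R\<^esub> \<longleftrightarrow> cls \<zero>\<^bsub>R\<^esub> = cls x" by auto
    then show ?thesis using that ab by (simp add: cls_iff)
  qed
  let ?f = "\<lambda>x::'a. [x]"
  let ?L = "push_module ?f (regular_module R)"
  have L: "module R ?L" "?f \<in> mod_hom R (regular_module R) ?L"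
    using push_module_inj[OF regular_module_module, of ?f] by (auto simp: inj_on_def)
  have hd: "hd \<in> mod_hom R ?L (regular_module R)"
    by (rule mod_hom_inverse[OF regular_module_module L(2)]) auto
  have free: "finite_free_module R ?L"
    by (rule regular_push_finite_free) (auto simp: inj_on_def)
  have mult: "(\<lambda>x. r \<otimes>\<^bsub>R\<^esub> x) \<in> mod_hom R (regular_module R) (regular_module R)"
    if "r \<in> carrier R" for r
    by (rule mod_homI) (use that in \<open>auto simp: r_distr m_lcomm\<close>)
  let ?\<epsilon> = "\<lambda>l. cls (hd l)"
  \<comment> \<open>\<open>\<delta> 0\<close> has to hit the kernel of \<open>cls\<close>, generated
    by \<open>a\<close>, and \<open>\<delta> 1\<close> that of multiplication by \<open>a\<close>,
    generated by \<open>b\<close>.\<close>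
  define \<delta> :: "nat \<Rightarrow> 'a list \<Rightarrow> 'a list"
    where "\<delta> i l = [(if i = 0 then a else b) \<otimes>\<^bsub>R\<^esub> hd l]" for i l
  have \<epsilon>: "?\<epsilon> \<in> mod_hom R ?L ?E" by (rule mod_hom_comp[OF hd cls])
  have \<delta>: "\<delta> i \<in> mod_hom R ?L ?L" for i
    unfolding \<delta>_def by (rule mod_hom_comp[OF mod_hom_comp[OF hd mult] L(2)]) (use ab in auto)
  \<comment> \<open>Wrapping in one-element lists is compatible with forming kernels, so exactness
    can be checked in the ring.\<close>
  have filter: "{l \<in> ?f ` carrier R. Q (hd l)} = ?f ` {x \<in> carrier R. Q x}" for Q by auto
  have \<delta>_im: "\<delta> i ` carrier ?L = ?f ` (\<lambda>y. (if i = 0 then a else b) \<otimes>\<^bsub>R\<^esub> y) ` carrier R" for i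
    by (simp add: \<delta>_def image_image)
  have "{x \<in> carrier R. cls x = cls \<zero>\<^bsub>R\<^esub>} = (\<lambda>y. a \<otimes>\<^bsub>R\<^esub> y) ` carrier R"
  proof -
    have "{x \<in> carrier R. cls x = cls \<zero>\<^bsub>R\<^esub>} = {x \<in> carrier R. \<exists>t \<in> carrier R. x = t \<otimes>\<^bsub>R\<^esub> a}"
      using cls0 by blast
    also have "\<dots> = (\<lambda>y. a \<otimes>\<^bsub>R\<^esub> y) ` carrier R"
      using ab by (auto simp: image_iff m_comm[of a])
    finally show ?thesis .
  qed
  then have "\<delta> 0 ` carrier ?L = a_kernel ?L ?E ?\<epsilon>"
    unfolding \<delta>_im a_kernel_def' using filter[of "\<lambda>x. cls x = cls \<zero>\<^bsub>R\<^esub>"] by simp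
  moreover have "\<delta> 1 ` carrier ?L = a_kernel ?L ?L (\<delta> 0)"
  proof -
    have "{x \<in> carrier R. a \<otimes>\<^bsub>R\<^esub> x = \<zero>\<^bsub>R\<^esub>} = (\<lambda>y. b \<otimes>\<^bsub>R\<^esub> y) ` carrier R"
      using ab by (auto simp: image_iff m_comm[of a] m_comm[of b] ann(1))
    then show ?thesis
      unfolding \<delta>_im a_kernel_def' using filter[of "\<lambda>x. a \<otimes>\<^bsub>R\<^esub> x = \<zero>\<^bsub>R\<^esub>"] by (simp add: \<delta>_def)
  qed
  ultimately have "aug_exact R ?E (\<lambda>_. ?L) ?\<epsilon> \<delta> 2"
    using E L(1) \<epsilon> \<delta> by (auto simp: aug_exact_def less_2_cases_iff diff_kernel_def image_image)
  then have "n_presented R 2 ?E" unfolding n_presented_def using free by blast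
  then have "proj_dim R ?E \<le> enat d" using nd E by (simp add: nd_ring_def)
  then obtain k where "has_projective_resolution R ?E k" using proj_dim_leD by blast
  then have exE: "annihilator_exact ?E a b (carrier ?E)"
    unfolding has_projective_resolution_def
    using annihilator_exact_of_resolution[OF _ _ _ ab ab0 ex] by blast
  have "\<exists>t \<in> carrier R. a = t \<otimes>\<^bsub>R\<^esub> a" using ab by (intro bexI[of _ "\<one>\<^bsub>R\<^esub>"]) auto
  then have "cls a = cls \<zero>\<^bsub>R\<^esub>" using cls0[OF ab(1)] by simp
  then have "a \<odot>\<^bsub>?E\<^esub> cls \<one>\<^bsub>R\<^esub> = \<zero>\<^bsub>?E\<^esub>"
    using mod_hom_smult[OF cls ab(1), of "\<one>\<^bsub>R\<^esub>"] ab by simp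
  moreover have "cls \<one>\<^bsub>R\<^esub> \<in> carrier ?E" by simp
  ultimately obtain y where y: "y \<in> carrier ?E" "cls \<one>\<^bsub>R\<^esub> = b \<odot>\<^bsub>?E\<^esub> y"
    using exE unfolding annihilator_exact_def by blast
  obtain s where s: "s \<in> carrier R" "y = cls s" using y(1) by auto
  have "cls (b \<otimes>\<^bsub>R\<^esub> s) = cls \<one>\<^bsub>R\<^esub>"
    using mod_hom_smult[OF cls ab(2), of s] s y(2) by simp
  then obtain t where "t \<in> carrier R" "\<one>\<^bsub>R\<^esub> = b \<otimes>\<^bsub>R\<^esub> s \<oplus>\<^bsub>R\<^esub> t \<otimes>\<^bsub>R\<^esub> a"
    using cls_iff[of "b \<otimes>\<^bsub>R\<^esub> s" "\<one>\<^bsub>R\<^esub>"] s(1) ab by auto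
  then show False using proper[OF s(1)] by blast
qed

text \<open>Finitely generated ideals of a valuation ring are principal, whence \<open>b\<close>.
  For the other annihilator let \<open>c \<otimes> b = \<zero>\<close>. If \<open>c\<close> is a
  multiple of \<open>a\<close>, this is the claim; if instead \<open>a = t c\<close>, then
  \<open>t\<close> turns out to be invertible, since otherwise \<open>a\<close> or \<open>b\<close>
  would vanish.\<close>

lemma valuation_ring_annihilator_pair:
  assumes R: "valuation_ring R" and a: "a \<in> zero_divisors R - {\<zero>\<^bsub>R\<^esub>}" and fg: "fg_ideal R (ann R a)"
  shows "\<exists>b \<in> carrier R. ann R a = PIdl\<^bsub>R\<^esub> b \<and> ann R b = PIdl\<^bsub>R\<^esub> a \<and> b \<noteq> \<zero>\<^bsub>R\<^esub>"
proof -
  interpret cring R using R by (simp add: valuation_ring_def)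
  obtain z where a: "a \<in> carrier R" "a \<noteq> \<zero>\<^bsub>R\<^esub>" and z: "z \<in> carrier R" "z \<noteq> \<zero>\<^bsub>R\<^esub>" "a \<otimes>\<^bsub>R\<^esub> z = \<zero>\<^bsub>R\<^esub>"
    using a by (auto simp: zero_divisors_def)
  have z_ann: "z \<in> ann R a" using z a by (simp add: ann_def m_comm)
  obtain S where S: "S \<subseteq> carrier R" "finite S" "ann R a = Idl\<^bsub>R\<^esub> S"
    using fg by (auto simp: fg_ideal_def)
  have "S \<noteq> {}"
  proof
    assume "S = {}"
    then have "Idl\<^bsub>R\<^esub> S \<subseteq> {\<zero>\<^bsub>R\<^esub>}" by (intro genideal_minimal zeroideal) auto
    then show False using S z z_ann by blast
  qed
  then obtain b where b: "b \<in> S" "\<And>x. x \<in> S \<Longrightarrow> \<exists>s \<in> carrier R. x = s \<otimes>\<^bsub>R\<^esub> b"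
    using valuation_ring_finite_divisor[OF R S(2) _ S(1)] by blast
  have bc: "b \<in> carrier R" using b S by blast
  have "ann R a = PIdl\<^bsub>R\<^esub> b"
    unfolding S(3)
  proof
    show "Idl\<^bsub>R\<^esub> S \<subseteq> PIdl\<^bsub>R\<^esub> b"
      by (rule genideal_minimal[OF cgenideal_ideal[OF bc]]) (use b in \<open>auto simp: cgenideal_def\<close>)
    show "PIdl\<^bsub>R\<^esub> b \<subseteq> Idl\<^bsub>R\<^esub> S"
      by (rule cgenideal_minimal[OF genideal_ideal[OF S(1)]]) (use genideal_self[OF S(1)] b in blast)
  qed
  then have anna: "x \<otimes>\<^bsub>R\<^esub> a = \<zero>\<^bsub>R\<^esub> \<longleftrightarrow> (\<exists>y \<in> carrier R. x = y \<otimes>\<^bsub>R\<^esub> b)" if "x \<in> carrier R" for x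
    using that by (auto simp: ann_def cgenideal_def)
  have b0: "b \<noteq> \<zero>\<^bsub>R\<^esub>"
    using anna[of z] z a by (auto simp: m_comm)
  have ba: "b \<otimes>\<^bsub>R\<^esub> a = \<zero>\<^bsub>R\<^esub>" using anna[OF bc] bc by (auto intro!: bexI[of _ "\<one>\<^bsub>R\<^esub>"])
  have "c \<in> PIdl\<^bsub>R\<^esub> a" if c: "c \<in> carrier R" "c \<otimes>\<^bsub>R\<^esub> b = \<zero>\<^bsub>R\<^esub>" for c
    using R c(1) a(1)
  proof (cases rule: valuation_ring_dvd_cases)
    case (1 s)
    then show ?thesis by (auto simp: cgenideal_def)
  next
    case (2 t)
    note t = 2
    \<comment> \<open>\<open>(0 : c) = (0 : t c) = (b)\<close>, so multiplication by \<open>t\<close> reflects membership in \<open>(b)\<close>.\<close>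
    from R bc t(1) show ?thesis
    proof (cases rule: valuation_ring_dvd_cases)
      case (1 y)
      \<comment> \<open>\<open>y a = y t c = b c = 0\<close>, so \<open>y\<close> is itself a
        multiple of \<open>b\<close>; substituting this gives \<open>b = u b\<close>.\<close>
      have "y \<otimes>\<^bsub>R\<^esub> a = c \<otimes>\<^bsub>R\<^esub> b" using 1 t c by (simp add: m_ac)
      then obtain w where w: "w \<in> carrier R" "y = w \<otimes>\<^bsub>R\<^esub> b" using anna 1 c by auto
      define u where "u = w \<otimes>\<^bsub>R\<^esub> t"
      have u: "u \<in> carrier R" using w t by (simp add: u_def)
      have bu: "b = u \<otimes>\<^bsub>R\<^esub> b"
        using 1(2) w bc t(1) unfolding u_def by (metis m_assoc m_comm)
      have uc: "\<one>\<^bsub>R\<^esub> \<ominus>\<^bsub>R\<^esub> u \<in> carrier R" using u by simp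
      have z0: "(\<one>\<^bsub>R\<^esub> \<ominus>\<^bsub>R\<^esub> u) \<otimes>\<^bsub>R\<^esub> b = \<zero>\<^bsub>R\<^esub>"
      proof -
        have "(\<one>\<^bsub>R\<^esub> \<ominus>\<^bsub>R\<^esub> u) \<otimes>\<^bsub>R\<^esub> b = b \<ominus>\<^bsub>R\<^esub> u \<otimes>\<^bsub>R\<^esub> b" using u bc by algebra
        then show ?thesis using bu bc by (simp add: a_minus_def r_neg)
      qed
      \<comment> \<open>If \<open>u\<close> divides \<open>1 - u\<close>, it divides 1, so
        \<open>t\<close> is invertible and \<open>c\<close> is a multiple of \<open>a\<close>. If
        \<open>1 - u\<close> divides \<open>u\<close>, then \<open>b = u b\<close> is a multiple of
        \<open>(1 - u) b = 0\<close>.\<close>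
      from R uc u show ?thesis
      proof (cases rule: valuation_ring_dvd_cases)
        case (1 v)
        have "\<one>\<^bsub>R\<^esub> = (\<one>\<^bsub>R\<^esub> \<ominus>\<^bsub>R\<^esub> u) \<oplus>\<^bsub>R\<^esub> u" using u by algebra
        also have "\<dots> = v \<otimes>\<^bsub>R\<^esub> u \<oplus>\<^bsub>R\<^esub> u" by (simp only: 1(2))
        also have "\<dots> = ((v \<oplus>\<^bsub>R\<^esub> \<one>\<^bsub>R\<^esub>) \<otimes>\<^bsub>R\<^esub> w) \<otimes>\<^bsub>R\<^esub> t" unfolding u_def using 1(1) w t(1) by algebra
        finally have "c \<otimes>\<^bsub>R\<^esub> \<one>\<^bsub>R\<^esub> = c \<otimes>\<^bsub>R\<^esub> (((v \<oplus>\<^bsub>R\<^esub> \<one>\<^bsub>R\<^esub>) \<otimes>\<^bsub>R\<^esub> w) \<otimes>\<^bsub>R\<^esub> t)" by simp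
        also have "\<dots> = ((v \<oplus>\<^bsub>R\<^esub> \<one>\<^bsub>R\<^esub>) \<otimes>\<^bsub>R\<^esub> w) \<otimes>\<^bsub>R\<^esub> a" unfolding t(2) using 1(1) w t(1) c(1) by algebra
        finally have "c = ((v \<oplus>\<^bsub>R\<^esub> \<one>\<^bsub>R\<^esub>) \<otimes>\<^bsub>R\<^esub> w) \<otimes>\<^bsub>R\<^esub> a" using c by simp
        then show ?thesis using 1(1) w by (auto simp: cgenideal_def)
      next
        case (2 v)
        have "b = v \<otimes>\<^bsub>R\<^esub> ((\<one>\<^bsub>R\<^esub> \<ominus>\<^bsub>R\<^esub> u) \<otimes>\<^bsub>R\<^esub> b)" using bu 2 uc bc by (metis m_assoc)
        then show ?thesis using z0 b0 2 by simp
      qed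
    next
      case (2 s)
      \<comment> \<open>With \<open>t\<close> a multiple of \<open>b\<close>, the product
        \<open>a = t c\<close> is a multiple of \<open>b c = 0\<close>.\<close>
      have "a = (s \<otimes>\<^bsub>R\<^esub> b) \<otimes>\<^bsub>R\<^esub> c" using t(2) by (simp only: 2(2))
      also have "\<dots> = s \<otimes>\<^bsub>R\<^esub> (c \<otimes>\<^bsub>R\<^esub> b)" using 2(1) c(1) bc by algebra
      finally have "a = s \<otimes>\<^bsub>R\<^esub> (c \<otimes>\<^bsub>R\<^esub> b)" .
      then show ?thesis using a c 2 by simp
    qed
  qed
  moreover have "a \<otimes>\<^bsub>R\<^esub> b = \<zero>\<^bsub>R\<^esub>" using ba m_comm[OF a(1) bc] by simp
  ultimately have "ann R b = PIdl\<^bsub>R\<^esub> a"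
    using a bc by (auto simp: ann_def cgenideal_def m_assoc)
  then show ?thesis using \<open>ann R a = PIdl\<^bsub>R\<^esub> b\<close> b0 bc by blast
qed

section \<open>2-presented modules\<close>

text \<open>Exactness at \<open>F 0\<close> makes the images of a basis of \<open>F 1\<close>
  generators of the kernel, exactness at \<open>F 1\<close> lets \<open>F 2\<close> parametrise
  their relations, and the coordinates of \<open>F 0\<close> separate points.\<close>

lemma kernel_finite_free:
  fixes E :: "('a, 'e) module" and F :: "nat \<Rightarrow> ('a, 'u) module"
  assumes R: "valuation_ring R"
    and ann: "\<And>a. a \<in> zero_divisors R - {\<zero>\<^bsub>R\<^esub>} \<Longrightarrow> \<not> fg_ideal R (ann R a)"
    and ex: "aug_exact R E F \<epsilon> \<delta> 2" and free: "\<And>i. i \<le> 2 \<Longrightarrow> finite_free_module R (F i)"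
  shows "finite_free_module R ((F 0)\<lparr>carrier := a_kernel (F 0) E \<epsilon>\<rparr>)"
proof -
  let ?K = "a_kernel (F 0) E \<epsilon>"
  let ?N = "(F 0)\<lparr>carrier := ?K\<rparr>"
  have F: "module R (F i)" if "i \<le> 2" for i using ex that by (simp add: aug_exact_def)
  have E: "module R E" and \<epsilon>: "\<epsilon> \<in> mod_hom R (F 0) E"
    using ex by (simp_all add: aug_exact_def)
  have \<delta>: "\<delta> i \<in> mod_hom R (F (Suc i)) (F i)"
    and im: "\<delta> i ` carrier (F (Suc i)) = diff_kernel E F \<epsilon> \<delta> i" if "i < 2" for i
    using ex that by (simp_all add: aug_exact_def)
  have \<delta>0: "\<delta> 0 \<in> mod_hom R (F 1) (F 0)" and \<delta>1: "\<delta> 1 \<in> mod_hom R (F 2) (F 1)"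
    using \<delta>[of 0] \<delta>[of 1] by (simp_all add: numeral_2_eq_2)
  have im0: "\<delta> 0 ` carrier (F 1) = ?K"
    and im1: "\<delta> 1 ` carrier (F 2) = a_kernel (F 1) (F 0) (\<delta> 0)"
    using im[of 0] im[of 1] by (simp_all add: numeral_2_eq_2 diff_kernel_def)
  have "\<exists>B. finite B \<and> module_basis R (F i) B" if "i \<le> 2" for i
    using free[OF that] by (simp add: finite_free_module_def)
  then obtain B where B: "\<And>i. i \<le> 2 \<Longrightarrow> finite (B i)" "\<And>i. i \<le> 2 \<Longrightarrow> module_basis R (F i) (B i)"
    by metis
  interpret F0: module R "F 0" by (rule F) simp
  interpret F1: module R "F 1" by (rule F) simp
  interpret F2: module R "F 2" by (rule F) simp
  have K: "submodule ?K R (F 0)" by (rule kernel_submodule[OF F0.module_axioms E \<epsilon>])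
  have N: "module R ?N" by (rule submodule.submodule_is_module[OF K F0.module_axioms])
  have Kc: "?K \<subseteq> carrier (F 0)" by (rule F0.submoduleE(1)[OF K])
  have B_0: "finite (B 0)" "module_basis R (F 0) (B 0)"
    and B_1: "finite (B 1)" "module_basis R (F 1) (B 1)"
    and B_2: "finite (B 2)" "module_basis R (F 2) (B 2)"
    using B by auto
  obtain \<pi> where \<pi>: "\<And>b. b \<in> B 0 \<Longrightarrow> \<pi> b \<in> mod_hom R (F 0) (regular_module R)"
    "\<And>x. x \<in> carrier (F 0) \<Longrightarrow> x = (\<Oplus>\<^bsub>F 0\<^esub>b\<in>B 0. \<pi> b x \<odot>\<^bsub>F 0\<^esub> b)"
    "\<And>c b. \<lbrakk>c \<in> B 0 \<rightarrow> carrier R; b \<in> B 0\<rbrakk> \<Longrightarrow> \<pi> b (\<Oplus>\<^bsub>F 0\<^esub>b\<in>B 0. c b \<odot>\<^bsub>F 0\<^esub> b) = c b"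
    by (rule finite_basis_coordinates[OF F0.module_axioms B_0]) (rule that)
  obtain \<sigma> where \<sigma>: "\<And>b. b \<in> B 1 \<Longrightarrow> \<sigma> b \<in> mod_hom R (F 1) (regular_module R)"
    "\<And>x. x \<in> carrier (F 1) \<Longrightarrow> x = (\<Oplus>\<^bsub>F 1\<^esub>b\<in>B 1. \<sigma> b x \<odot>\<^bsub>F 1\<^esub> b)"
    "\<And>c b. \<lbrakk>c \<in> B 1 \<rightarrow> carrier R; b \<in> B 1\<rbrakk> \<Longrightarrow> \<sigma> b (\<Oplus>\<^bsub>F 1\<^esub>b\<in>B 1. c b \<odot>\<^bsub>F 1\<^esub> b) = c b"
    by (rule finite_basis_coordinates[OF F1.module_axioms B_1]) (rule that)
  have B0: "B 0 \<subseteq> carrier (F 0)"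
    using module_basis_finite_iff[OF F0.module_axioms B_0(1)] B_0(2) by auto
  have B1: "B 1 \<subseteq> carrier (F 1)"
    using module_basis_finite_iff[OF F1.module_axioms B_1(1)] B_1(2) by auto
  have B2: "B 2 \<subseteq> carrier (F 2)"
    "\<And>g. g \<in> carrier (F 2) \<Longrightarrow> \<exists>c \<in> B 2 \<rightarrow> carrier R. g = (\<Oplus>\<^bsub>F 2\<^esub>t\<in>B 2. c t \<odot>\<^bsub>F 2\<^esub> t)"
    using module_basis_finite_iff[OF F2.module_axioms B_2(1)] B_2(2) by auto
  have id1: "(\<lambda>b. b) \<in> B 1 \<rightarrow> carrier (F 1)" using B1 by auto
  have separating: "y = \<zero>\<^bsub>F 0\<^esub>"
    if y: "y \<in> carrier (F 0)" and 0: "\<And>\<rho>. \<rho> \<in> \<pi> ` B 0 \<Longrightarrow> \<rho> y = \<zero>\<^bsub>R\<^esub>" for y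
  proof -
    have "y = (\<Oplus>\<^bsub>F 0\<^esub>b\<in>B 0. \<pi> b y \<odot>\<^bsub>F 0\<^esub> b)" by (rule \<pi>(2)[OF y])
    also have "\<dots> = (\<Oplus>\<^bsub>F 0\<^esub>b\<in>B 0. \<zero>\<^bsub>F 0\<^esub>)"
      by (rule F0.M.finsum_cong') (use 0[OF imageI] B0 in auto)
    finally show ?thesis by simp
  qed
  \<comment> \<open>Via the basis of \<open>F 1\<close>, relations among the generators are elements
    of the kernel of \<open>\<delta> 0\<close>, that is, of the image of \<open>\<delta> 1\<close>;
    the coordinates \<open>\<sigma>\<close> read them off.\<close>
  have syz: "(\<Oplus>\<^bsub>F 0\<^esub>b\<in>B 1. r b \<odot>\<^bsub>F 0\<^esub> \<delta> 0 b) = \<zero>\<^bsub>F 0\<^esub> \<longleftrightarrow>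
      (\<exists>g \<in> carrier (F 2). \<forall>b \<in> B 1. r b = \<sigma> b (\<delta> 1 g))"
    if r: "r \<in> B 1 \<rightarrow> carrier R" for r
  proof -
    let ?v = "\<Oplus>\<^bsub>F 1\<^esub>b\<in>B 1. r b \<odot>\<^bsub>F 1\<^esub> b"
    have v: "?v \<in> carrier (F 1)" by (rule F1.lincomb_closed[OF r id1])
    have "(\<Oplus>\<^bsub>F 0\<^esub>b\<in>B 1. r b \<odot>\<^bsub>F 0\<^esub> \<delta> 0 b) = \<delta> 0 ?v"
      by (rule mod_hom_lincomb[OF F1.module_axioms F0.module_axioms \<delta>0 B_1(1) id1 r, symmetric])
    then have "(\<Oplus>\<^bsub>F 0\<^esub>b\<in>B 1. r b \<odot>\<^bsub>F 0\<^esub> \<delta> 0 b) = \<zero>\<^bsub>F 0\<^esub> \<longleftrightarrow> ?v \<in> a_kernel (F 1) (F 0) (\<delta> 0)"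
      using v by (simp add: a_kernel_def')
    also have "\<dots> \<longleftrightarrow> (\<exists>g \<in> carrier (F 2). ?v = \<delta> 1 g)"
      unfolding im1[symmetric] by blast
    also have "\<dots> \<longleftrightarrow> (\<exists>g \<in> carrier (F 2). \<forall>b \<in> B 1. r b = \<sigma> b (\<delta> 1 g))"
    proof (rule bex_cong[OF refl])
      fix g assume g: "g \<in> carrier (F 2)"
      have dg: "\<delta> 1 g \<in> carrier (F 1)" by (rule mod_hom_closed[OF \<delta>1 g])
      show "?v = \<delta> 1 g \<longleftrightarrow> (\<forall>b \<in> B 1. r b = \<sigma> b (\<delta> 1 g))"
      proof
        assume "?v = \<delta> 1 g"
        then show "\<forall>b \<in> B 1. r b = \<sigma> b (\<delta> 1 g)" using \<sigma>(3)[OF r] by metis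
      next
        assume eq: "\<forall>b \<in> B 1. r b = \<sigma> b (\<delta> 1 g)"
        have "?v = (\<Oplus>\<^bsub>F 1\<^esub>b\<in>B 1. \<sigma> b (\<delta> 1 g) \<odot>\<^bsub>F 1\<^esub> b)"
          by (rule F1.lincomb_cong) (use eq r id1 in \<open>auto simp: Pi_iff\<close>)
        then show "?v = \<delta> 1 g" using \<sigma>(2)[OF dg] by simp
      qed
    qed
    finally show ?thesis .
  qed
  have "\<exists>C. finite C \<and> C \<subseteq> carrier (F 0) \<and> F0.independent C \<and>
      (\<forall>H. submodule H R (F 0) \<longrightarrow> \<delta> 0 ` B 1 \<subseteq> H \<longleftrightarrow> C \<subseteq> H)"
  proof (rule finitely_presented_submodule_basis[OF R ann F0.module_axioms F2.module_axioms
        B_2(1) B2 _ _ separating B_1(1) _ _ syz])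
    show "finite (\<pi> ` B 0)" using B_0(1) by simp
    show "\<pi> ` B 0 \<subseteq> mod_hom R (F 0) (regular_module R)" using \<pi>(1) by blast
    show "\<delta> 0 \<in> B 1 \<rightarrow> carrier (F 0)" using mod_hom_closed[OF \<delta>0] B1 by auto
    show "(\<lambda>b g. \<sigma> b (\<delta> 1 g)) \<in> B 1 \<rightarrow> mod_hom R (F 2) (regular_module R)"
      using mod_hom_comp[OF \<delta>1 \<sigma>(1)] by auto
  qed auto
  then obtain C where C: "finite C" "C \<subseteq> carrier (F 0)" "F0.independent C"
    and span: "\<And>H. submodule H R (F 0) \<Longrightarrow> \<delta> 0 ` B 1 \<subseteq> H \<longleftrightarrow> C \<subseteq> H" by blast
  have idC: "(\<lambda>b. b) \<in> C \<rightarrow> carrier (F 0)" using C(2) by auto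
  have "\<delta> 0 ` B 1 \<subseteq> ?K" using im0 B1 by blast
  then have CK: "C \<subseteq> ?K" using span[OF K] by blast
  \<comment> \<open>The inclusion of the kernel is linear, so sums in the restricted module agree
    with sums in \<open>F 0\<close>.\<close>
  have sum_N: "(\<Oplus>\<^bsub>?N\<^esub>b\<in>C. c b \<odot>\<^bsub>?N\<^esub> b) = (\<Oplus>\<^bsub>F 0\<^esub>b\<in>C. c b \<odot>\<^bsub>F 0\<^esub> b)" if "c \<in> C \<rightarrow> carrier R" for c
    by (rule mod_hom_lincomb[OF N F0.module_axioms _ C(1) _ that, of "\<lambda>x. x"])
      (use CK Kc in \<open>auto intro!: mod_homI\<close>)
  \<comment> \<open>The span of \<open>C\<close>, one more submodule to which \<open>span\<close>
    applies: as it contains \<open>C\<close>, it contains the generators and therefore the whole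
    kernel.\<close>
  define H where "H = (\<lambda>c. \<Oplus>\<^bsub>F 0\<^esub>b\<in>C. c b \<odot>\<^bsub>F 0\<^esub> b) ` (C \<rightarrow> carrier R)"
  have H_I: "(\<Oplus>\<^bsub>F 0\<^esub>b\<in>C. c b \<odot>\<^bsub>F 0\<^esub> b) \<in> H" if "c \<in> C \<rightarrow> carrier R" for c
    unfolding H_def using that by (rule imageI)
  have H_add: "u \<oplus>\<^bsub>F 0\<^esub> v \<in> H" if uv: "u \<in> H" "v \<in> H" for u v
  proof -
    obtain c where c: "c \<in> C \<rightarrow> carrier R" "u = (\<Oplus>\<^bsub>F 0\<^esub>b\<in>C. c b \<odot>\<^bsub>F 0\<^esub> b)"
      using uv(1) unfolding H_def by blast
    obtain d where d: "d \<in> C \<rightarrow> carrier R" "v = (\<Oplus>\<^bsub>F 0\<^esub>b\<in>C. d b \<odot>\<^bsub>F 0\<^esub> b)"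
      using uv(2) unfolding H_def by blast
    have "u \<oplus>\<^bsub>F 0\<^esub> v = (\<Oplus>\<^bsub>F 0\<^esub>b\<in>C. (c b \<oplus>\<^bsub>R\<^esub> d b) \<odot>\<^bsub>F 0\<^esub> b)"
      unfolding c(2) d(2) by (rule F0.lincomb_add[OF c(1) d(1) idC, symmetric])
    also have "\<dots> \<in> H" by (rule H_I) (use c(1) d(1) in \<open>simp add: Pi_iff\<close>)
    finally show ?thesis .
  qed
  have H_smult: "a \<odot>\<^bsub>F 0\<^esub> u \<in> H" if a: "a \<in> carrier R" and u: "u \<in> H" for a u
  proof -
    obtain c where c: "c \<in> C \<rightarrow> carrier R" "u = (\<Oplus>\<^bsub>F 0\<^esub>b\<in>C. c b \<odot>\<^bsub>F 0\<^esub> b)"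
      using u unfolding H_def by blast
    have "a \<odot>\<^bsub>F 0\<^esub> u = (\<Oplus>\<^bsub>F 0\<^esub>b\<in>C. (a \<otimes>\<^bsub>R\<^esub> c b) \<odot>\<^bsub>F 0\<^esub> b)"
      unfolding c(2) by (rule F0.lincomb_smult[OF C(1) a c(1) idC, symmetric])
    also have "\<dots> \<in> H" by (rule H_I) (use c(1) a in \<open>simp add: Pi_iff\<close>)
    finally show ?thesis .
  qed
  have Hc: "H \<subseteq> carrier (F 0)"
    unfolding H_def using F0.lincomb_closed[OF _ idC] by blast
  have C_H: "b \<in> H" if b: "b \<in> C" for b
  proof -
    let ?c = "\<lambda>i. if i = b then \<one>\<^bsub>R\<^esub> else \<zero>\<^bsub>R\<^esub>"
    have "b = (\<Oplus>\<^bsub>F 0\<^esub>i\<in>C. ?c i \<odot>\<^bsub>F 0\<^esub> i)"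
      using F0.lincomb_single[OF C(1) b idC, of "\<one>\<^bsub>R\<^esub>"] b C(2) by auto
    also have "\<dots> \<in> H" by (rule H_I) auto
    finally show ?thesis .
  qed
  have H: "submodule H R (F 0)"
  proof (rule F0.submoduleI[OF Hc _ _ H_add H_smult])
    have "(\<Oplus>\<^bsub>F 0\<^esub>b\<in>C. \<zero>\<^bsub>R\<^esub> \<odot>\<^bsub>F 0\<^esub> b) = (\<Oplus>\<^bsub>F 0\<^esub>b\<in>C. \<zero>\<^bsub>F 0\<^esub>)"
      by (rule F0.M.finsum_cong') (use C(2) in auto)
    then have "\<zero>\<^bsub>F 0\<^esub> = (\<Oplus>\<^bsub>F 0\<^esub>b\<in>C. \<zero>\<^bsub>R\<^esub> \<odot>\<^bsub>F 0\<^esub> b)" by simp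
    also have "\<dots> \<in> H" by (rule H_I) simp
    finally show "\<zero>\<^bsub>F 0\<^esub> \<in> H" .
    fix u assume u: "u \<in> H"
    then have "u \<in> carrier (F 0)" using Hc by blast
    then show "\<ominus>\<^bsub>F 0\<^esub> u \<in> H" using H_smult[OF _ u, of "\<ominus>\<^bsub>R\<^esub> \<one>\<^bsub>R\<^esub>"]
      by (simp add: F0.smult_minus_one)
  qed
  have gens: "\<delta> 0 ` B 1 \<subseteq> H" using span[OF H] C_H by blast
  have KH: "?K \<subseteq> H"
  proof
    fix x assume "x \<in> ?K"
    then obtain v where v: "v \<in> carrier (F 1)" "x = \<delta> 0 v" unfolding im0[symmetric] by blast
    have s: "(\<lambda>b. \<sigma> b v) \<in> B 1 \<rightarrow> carrier R" using mod_hom_closed[OF \<sigma>(1) v(1)] by auto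
    have "x = \<delta> 0 (\<Oplus>\<^bsub>F 1\<^esub>b\<in>B 1. \<sigma> b v \<odot>\<^bsub>F 1\<^esub> b)" using v \<sigma>(2)[OF v(1)] by simp
    also have "\<dots> = (\<Oplus>\<^bsub>F 0\<^esub>b\<in>B 1. \<sigma> b v \<odot>\<^bsub>F 0\<^esub> \<delta> 0 b)"
      by (rule mod_hom_lincomb[OF F1.module_axioms F0.module_axioms \<delta>0 B_1(1) id1 s])
    also have "\<dots> \<in> H"
      by (rule F0.submodule_lincomb[OF H B_1(1) _ s]) (use gens in auto)
    finally show "x \<in> H" .
  qed
  have "module_basis R ?N C"
    unfolding module_basis_finite_iff[OF N C(1)]
  proof (intro conjI ballI)
    show "C \<subseteq> carrier ?N" using CK by simp
    show "module.independent R ?N C"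
      using C(3) sum_N by (simp add: module.independent_def[OF N] F0.independent_def)
    fix x assume "x \<in> carrier ?N"
    then have "x \<in> H" using KH by auto
    then show "\<exists>c \<in> C \<rightarrow> carrier R. x = (\<Oplus>\<^bsub>?N\<^esub>b\<in>C. c b \<odot>\<^bsub>?N\<^esub> b)"
      using sum_N unfolding H_def by auto
  qed
  then show ?thesis using N C(1) unfolding finite_free_module_def by blast
qed

text \<open>The resolution is the inclusion of the free kernel into \<open>F\<close>. Since the
  definition prescribes lists over a sum type as carriers, both modules are copied there by
  \<open>map Inl\<close>.\<close>

lemma has_projective_resolution_1:
  fixes E :: "('a, 'm) module" and F :: "('a, 'a list) module"
  assumes E: "module R E" and F: "finite_free_module R F" and \<epsilon>: "\<epsilon> \<in> mod_hom R F E"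
    and surj: "\<epsilon> ` carrier F = carrier E"
    and K: "finite_free_module R (F\<lparr>carrier := a_kernel F E \<epsilon>\<rparr>)"
  shows "has_projective_resolution R E 1"
proof -
  define i where "i = (map Inl :: 'a list \<Rightarrow> ('a + 'm) list)"
  define j where "j = (map projl :: ('a + 'm) list \<Rightarrow> 'a list)"
  have ji [simp]: "j (i l) = l" for l by (simp add: i_def j_def comp_def)
  let ?N = "F\<lparr>carrier := a_kernel F E \<epsilon>\<rparr>"
  have inj: "inj_on i A" for A by (metis ji inj_onI)
  have mF: "module R F" and mN: "module R ?N" using F K by (simp_all add: finite_free_module_def)
  interpret F: module R F by (rule mF)
  define P where "P n = (if n = 0 then push_module i F else push_module i ?N)" for n :: nat
  note pF = push_module_inj[OF mF inj[of "carrier F"]]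
  note pN = push_module_inj[OF mN inj[of "carrier ?N"]]
  have jF: "j \<in> mod_hom R (push_module i F) F"
    by (rule mod_hom_inverse[OF mF pF(2)]) auto
  have jN: "j \<in> mod_hom R (push_module i ?N) ?N"
    by (rule mod_hom_inverse[OF mN pN(2)]) auto
  have incl: "(\<lambda>x. x) \<in> mod_hom R ?N F"
    by (rule mod_homI) (auto simp: a_kernel_def')
  let ?\<epsilon> = "\<lambda>l. \<epsilon> (j l)"
  \<comment> \<open>On the range of \<open>i\<close> this is the identity, so it is the inclusion of
    the copied kernel.\<close>
  let ?\<delta> = "\<lambda>(_::nat) l. i (j l)"
  have "?\<epsilon> \<in> mod_hom R (P 0) E"
    unfolding P_def using mod_hom_comp[OF jF \<epsilon>] by simp
  moreover have "?\<delta> 0 \<in> mod_hom R (P (Suc 0)) (P 0)"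
    unfolding P_def using mod_hom_comp[OF mod_hom_comp[OF jN incl] pF(2)] by simp
  moreover have "?\<delta> 0 ` carrier (P (Suc 0)) = a_kernel (P 0) E ?\<epsilon>"
    by (auto simp: P_def a_kernel_def' image_iff)
  moreover have "?\<epsilon> ` carrier (P 0) = carrier E"
    using surj by (simp add: P_def image_image)
  ultimately have "aug_exact R E P ?\<epsilon> ?\<delta> 1"
    using E pF(1) pN(1) by (auto simp: aug_exact_def diff_kernel_def P_def)
  moreover have "projective_module R (P n)" for n
    unfolding P_def using finite_free_push_projective[OF F inj] finite_free_push_projective[OF K inj]
    by simp
  moreover have "diff_kernel E P ?\<epsilon> ?\<delta> 1 = {\<zero>\<^bsub>P 1\<^esub>}"
    using mod_hom_zero[OF mF E \<epsilon>] by (auto simp: diff_kernel_def P_def a_kernel_def')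
  ultimately show ?thesis unfolding has_projective_resolution_def by blast
qed

theorem theorem3p1:
  fixes A :: "('a, 'r) ring_scheme"
  assumes "valuation_ring A"
  shows "((\<forall>a \<in> zero_divisors A - {\<zero>\<^bsub>A\<^esub>}. \<not> fg_ideal A (ann A a)) \<longrightarrow> nd_ring A 2 1) \<and>
         ((\<exists>a \<in> zero_divisors A - {\<zero>\<^bsub>A\<^esub>}. fg_ideal A (ann A a)) \<longrightarrow>
            (\<forall>d :: nat. \<not> nd_ring A 2 d))"
proof (intro conjI impI allI)
  interpret cring A using assms by (simp add: valuation_ring_def)
  {
    assume ann: "\<forall>a \<in> zero_divisors A - {\<zero>\<^bsub>A\<^esub>}. \<not> fg_ideal A (ann A a)"
    show "nd_ring A 2 1"
      unfolding nd_ring_def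
    proof (intro conjI allI impI)
      show "cring A" ..
      fix E :: "('a, 'a list set) module"
      assume "module A E \<and> n_presented A 2 E"
      then obtain F :: "nat \<Rightarrow> ('a, 'a list) module" and \<epsilon> \<delta>
        where ex: "aug_exact A E F \<epsilon> \<delta> 2" and free: "\<forall>i \<le> 2. finite_free_module A (F i)"
        unfolding n_presented_def by blast
      have "finite_free_module A ((F 0)\<lparr>carrier := a_kernel (F 0) E \<epsilon>\<rparr>)"
        using kernel_finite_free[OF assms _ ex] ann free by blast
      then have "has_projective_resolution A E 1"
        using has_projective_resolution_1[of A E "F 0" \<epsilon>] ex free by (simp add: aug_exact_def)
      then show "proj_dim A E \<le> enat 1"
        unfolding proj_dim_def by (intro Inf_lower) blast
    qed
  }
  fix d
  assume "\<exists>a \<in> zero_divisors A - {\<zero>\<^bsub>A\<^esub>}. fg_ideal A (ann A a)"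
  then obtain a where zd: "a \<in> zero_divisors A - {\<zero>\<^bsub>A\<^esub>}" and fg: "fg_ideal A (ann A a)" by blast
  then have a: "a \<in> carrier A" and a0: "a \<noteq> \<zero>\<^bsub>A\<^esub>" by (auto simp: zero_divisors_def)
  obtain b where b: "b \<in> carrier A" "b \<noteq> \<zero>\<^bsub>A\<^esub>"
    and ann: "ann A a = PIdl\<^bsub>A\<^esub> b" "ann A b = PIdl\<^bsub>A\<^esub> a"
    using valuation_ring_annihilator_pair[OF assms zd fg] by blast
  have ba: "b \<otimes>\<^bsub>A\<^esub> a = \<zero>\<^bsub>A\<^esub>"
    using cgenideal_self[OF b(1)] unfolding ann(1)[symmetric] by (simp add: ann_def)
  show "\<not> nd_ring A 2 d"
  proof (rule not_nd_ring_if_exact_pair[OF is_cring a b(1) ann])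
    fix s t assume st: "s \<in> carrier A" "t \<in> carrier A"
    show "\<one>\<^bsub>A\<^esub> \<noteq> b \<otimes>\<^bsub>A\<^esub> s \<oplus>\<^bsub>A\<^esub> t \<otimes>\<^bsub>A\<^esub> a"
    proof
      assume one: "\<one>\<^bsub>A\<^esub> = b \<otimes>\<^bsub>A\<^esub> s \<oplus>\<^bsub>A\<^esub> t \<otimes>\<^bsub>A\<^esub> a"
      \<comment> \<open>Of two comparable principal ideals, the generator of the smaller one squares
        to zero because \<open>b a = 0\<close>. Multiplying the equation for 1 by this generator
        makes it vanish.\<close>
      show False
        using assms a b(1)
      proof (cases rule: valuation_ring_dvd_cases)
        case (1 r)
        have "a \<otimes>\<^bsub>A\<^esub> a = (r \<otimes>\<^bsub>A\<^esub> b) \<otimes>\<^bsub>A\<^esub> a" by (simp only: 1(2)[symmetric])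
        also have "\<dots> = \<zero>\<^bsub>A\<^esub>" using 1(1) a b(1) ba by (simp add: m_assoc)
        finally have aa: "a \<otimes>\<^bsub>A\<^esub> a = \<zero>\<^bsub>A\<^esub>" .
        have "a = (b \<otimes>\<^bsub>A\<^esub> s \<oplus>\<^bsub>A\<^esub> t \<otimes>\<^bsub>A\<^esub> a) \<otimes>\<^bsub>A\<^esub> a" using a unfolding one[symmetric] by simp
        also have "\<dots> = (b \<otimes>\<^bsub>A\<^esub> a) \<otimes>\<^bsub>A\<^esub> s \<oplus>\<^bsub>A\<^esub> t \<otimes>\<^bsub>A\<^esub> (a \<otimes>\<^bsub>A\<^esub> a)"
          using st a b(1) by algebra
        finally show ?thesis using ba aa a0 st by simp
      next
        case (2 r)
        have "b \<otimes>\<^bsub>A\<^esub> b = b \<otimes>\<^bsub>A\<^esub> (r \<otimes>\<^bsub>A\<^esub> a)" by (simp only: 2(2)[symmetric])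
        also have "\<dots> = r \<otimes>\<^bsub>A\<^esub> (b \<otimes>\<^bsub>A\<^esub> a)" using 2(1) a b(1) by algebra
        finally have bb: "b \<otimes>\<^bsub>A\<^esub> b = \<zero>\<^bsub>A\<^esub>" using ba 2(1) by simp
        have "b = (b \<otimes>\<^bsub>A\<^esub> s \<oplus>\<^bsub>A\<^esub> t \<otimes>\<^bsub>A\<^esub> a) \<otimes>\<^bsub>A\<^esub> b" using b unfolding one[symmetric] by simp
        also have "\<dots> = (b \<otimes>\<^bsub>A\<^esub> b) \<otimes>\<^bsub>A\<^esub> s \<oplus>\<^bsub>A\<^esub> t \<otimes>\<^bsub>A\<^esub> (b \<otimes>\<^bsub>A\<^esub> a)"
          using st a b(1) by algebra
        finally show ?thesis using ba bb b(2) st by simp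
      qed
    qed
  qed
qed

end
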